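(* Let $u$ be the solution of the elastodynamic equation $\rho\ddot u=\mathbb{C}u_{xx}+b$ and, for each $\epsilon>0$, let $u_l^\epsilon$ be the solution of the linearized peridynamic equation $\rho\ddot u_l^\epsilon(t,x)=-\nabla PD_l^\epsilon(u_l^\epsilon(t))(x)+b(t,x)$, for $(x,t)\in D\times J$, with the initial and boundary conditions described in the context. Let $e_l^\epsilon:=u_l^\epsilon-u$. Suppose $u_l^\epsilon(t)\in C^4(D)$ for all $\epsilon>0$ and $t\in[0,T]$, and suppose there exists $C_1>0$, independent of $\epsilon$, such that $$\sup_{\epsilon>0}\Big\{\sup_{(x,t)\in D\times J}|(u_l^\epsilon)_{xxxx}(t,x)|\Big\}<C_1<\infty .$$ Then there is a constant $C_2>0$, independent of $\delta$ and $\epsilon$, such that $$\sup_{t\in[0,T]}\Big\{\int_D\rho|\dot e_l^\epsilon(t,x)|^2\,dx+\int_D\mathbb{C}|(e_l^\epsilon)_x(t,x)|^2\,dx\Big\}\le C_2\epsilon^4,$$ so that $u_l^\epsilon\to u$ in the $H^1(D)$ norm at the rate $\epsilon^2$ uniformly in time $t\in[0,T]$ (that is, $\sup_{t\in[0,T]}\|u_l^\epsilon(t)-u(t)\|_1\le C\epsilon^2$ with $C$ independent of $\epsilon$).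
   Context: $D=[a,b]\subset\mathbb{R}$ is a bounded interval, $J=[0,T]$ is the time interval (the same letter $J$ is also used for the influence function below), and $\epsilon>0$ is the horizon. The nonlocal boundary is $\partial D^\epsilon=(a-\epsilon,a+\epsilon)\cup(b-\epsilon,b+\epsilon)$. The strain is $S(y,x;u)=\frac{u(y)-u(x)}{|y-x|}$. The function $f:[0,\infty)\to\mathbb{R}$ is positive (for $r>0$), smooth and concave with $\lim_{r\to0^+}f(r)/r=f'(0)$ and $\lim_{r\to\infty}f(r)=f_\infty<\infty$. The influence function $J(|\xi|)$ is (measurable and) zero for $\xi$ outside $[-1,1]$ and satisfies $0\le J(|\xi|)\le M$ on $[-1,1]$. The linearized peridynamic force is $$-\nabla PD_l^\epsilon(u)(x)=\frac{2}{\epsilon^2}\int_{x-\epsilon}^{x+\epsilon}J(|y-x|/\epsilon)\,f'(0)\,S(y,x;u)\,dy .$$ The Young's modulus is $\mathbb{C}=\int_{-1}^1J(|z|)f'(0)|z|\,dz$, and it is positive. The mass density $\rho>0$ is constant and $b(t,x)$ is a prescribed body force, the same in both equations. Boundary conditions: $u_l^\epsilon(t,x)=0$ and $\dot u_l^\epsilon(t,x)=0$ for all $t\in[0,T]$, $x\in\partial D^\epsilon$; $u=0$ (and $\dot u=0$) at the endpoints of $D$, and $u$ is extended by zero outside $D$. Initial conditions (the same for $u_l^\epsilon$ and $u$): $u_l^\epsilon(0,x)=g(x)$, $\dot u_l^\epsilon(0,x)=h(x)$ for $x\in D$, where $g=h=0$ outside some fixed subset $D'$ of $D$; $\delta$ denotes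 the width of the layer $D\setminus D'$. $C^4(D)$ is the space of functions with four continuous derivatives on $D$, and $\|v\|_1=\sqrt{\int_D|v|^2dx+\int_D|v_x|^2dx}$. *)

theory Defs
  imports "HOL-Analysis.Analysis"
begin

text \<open>Derivative relative to a set, hence one-sided at the endpoints of a closed interval. Its
  iterates are the higher derivatives. A value is meaningful only where the function is
  differentiable within \<open>S\<close>.\<close>

definition deriv_on :: "real set \<Rightarrow> (real \<Rightarrow> real) \<Rightarrow> real \<Rightarrow> real" where
  "deriv_on S v = (\<lambda>x. vector_derivative v (at x within S))"

definition C_k_on :: "nat \<Rightarrow> real set \<Rightarrow> (real \<Rightarrow> real) \<Rightarrow> bool" where
  "C_k_on k S v \<longleftrightarrow>
     (\<forall>j<k. ((deriv_on S ^^ j) v) differentiable_on S) \<and>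
     continuous_on S ((deriv_on S ^^ k) v)"

definition admissible_potential :: "(real \<Rightarrow> real) \<Rightarrow> bool" where
  "admissible_potential f \<longleftrightarrow>
     (\<forall>r>0. f r > 0) \<and>
     (\<forall>k. C_k_on k {0..} f) \<and>
     concave_on {0..} f \<and>
     ((\<lambda>r. f r / r) \<longlongrightarrow> deriv_on {0..} f 0) (at_right 0) \<and>
     (\<exists>f_inf. (f \<longlongrightarrow> f_inf) at_top)"

definition influence_function :: "real \<Rightarrow> (real \<Rightarrow> real) \<Rightarrow> bool" where
  "influence_function M J \<longleftrightarrow>
     (\<lambda>\<xi>. J \<bar>\<xi>\<bar>) \<in> borel_measurable lebesgue \<and>
     (\<forall>\<xi>. \<xi> \<notin> {-1..1} \<longrightarrow> J \<bar>\<xi>\<bar> = 0) \<and>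
     (\<forall>\<xi>\<in>{-1..1}. 0 \<le> J \<bar>\<xi>\<bar> \<and> J \<bar>\<xi>\<bar> \<le> M)"

definition youngs_modulus :: "(real \<Rightarrow> real) \<Rightarrow> (real \<Rightarrow> real) \<Rightarrow> real" where
  "youngs_modulus f J = integral {-1..1} (\<lambda>z. J \<bar>z\<bar> * deriv_on {0..} f 0 * \<bar>z\<bar>)"

definition strain :: "real \<Rightarrow> real \<Rightarrow> (real \<Rightarrow> real) \<Rightarrow> real" where
  "strain y x v = (v y - v x) / \<bar>y - x\<bar>"

text \<open>The linearized peridynamic force, that is, minus the gradient of the potential (the minus
  sign is part of the definition).\<close>

definition peridynamic_force ::
    "(real \<Rightarrow> real) \<Rightarrow> (real \<Rightarrow> real) \<Rightarrow> real \<Rightarrow> (real \<Rightarrow> real) \<Rightarrow> real \<Rightarrow> real" where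
  "peridynamic_force f J \<epsilon> v x =
     2 / \<epsilon>\<^sup>2 * integral {x - \<epsilon>..x + \<epsilon>}
       (\<lambda>y. J (\<bar>y - x\<bar> / \<epsilon>) * deriv_on {0..} f 0 * strain y x v)"

definition nonlocal_boundary :: "real \<Rightarrow> real \<Rightarrow> real \<Rightarrow> real set" where
  "nonlocal_boundary a b \<epsilon> = {a - \<epsilon><..<a + \<epsilon>} \<union> {b - \<epsilon><..<b + \<epsilon>}"

text \<open>Functions of time and space take the time argument first.\<close>

definition initial_data ::
    "real \<Rightarrow> real \<Rightarrow> real \<Rightarrow> (real \<Rightarrow> real) \<Rightarrow> (real \<Rightarrow> real) \<Rightarrow> (real \<Rightarrow> real \<Rightarrow> real) \<Rightarrow> bool" where
  "initial_data a b T g h w \<longleftrightarrow>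
     (\<forall>x\<in>{a..b}. w 0 x = g x \<and> deriv_on {0..T} (\<lambda>s. w s x) 0 = h x)"

text \<open>No joint regularity in \<open>(t, x)\<close> is required of a solution of the nonlocal equation: the
  equation is read pointwise in \<open>x\<close>, for functions that are twice continuously differentiable
  in time.\<close>

definition peridynamic_solution ::
    "real \<Rightarrow> real \<Rightarrow> real \<Rightarrow> real \<Rightarrow> (real \<Rightarrow> real) \<Rightarrow> (real \<Rightarrow> real) \<Rightarrow> (real \<Rightarrow> real \<Rightarrow> real) \<Rightarrow>
     (real \<Rightarrow> real) \<Rightarrow> (real \<Rightarrow> real) \<Rightarrow> real \<Rightarrow> (real \<Rightarrow> real \<Rightarrow> real) \<Rightarrow> bool" where
  "peridynamic_solution a b T \<rho> f J body g h \<epsilon> w \<longleftrightarrow>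
     (\<forall>x\<in>{a..b}. C_k_on 2 {0..T} (\<lambda>s. w s x)) \<and>
     (\<forall>t\<in>{0..T}. \<forall>x\<in>{a..b}.
        \<rho> * (deriv_on {0..T} ^^ 2) (\<lambda>s. w s x) t = peridynamic_force f J \<epsilon> (w t) x + body t x) \<and>
     (\<forall>t\<in>{0..T}. \<forall>x\<in>nonlocal_boundary a b \<epsilon>.
        w t x = 0 \<and> deriv_on {0..T} (\<lambda>s. w s x) t = 0) \<and>
     initial_data a b T g h w"

text \<open>Classical solutions of the wave equation: the derivatives in the equation, and those of lower
  order, exist and are continuous on the closed space-time rectangle. Mixed derivatives are not
  required to exist, so every twice continuously differentiable solution is covered.\<close>

definition elastodynamic_solution ::
    "real \<Rightarrow> real \<Rightarrow> real \<Rightarrow> real \<Rightarrow> real \<Rightarrow> (real \<Rightarrow> real \<Rightarrow> real) \<Rightarrow>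
     (real \<Rightarrow> real) \<Rightarrow> (real \<Rightarrow> real) \<Rightarrow> (real \<Rightarrow> real \<Rightarrow> real) \<Rightarrow> bool" where
  "elastodynamic_solution a b T \<rho> Y body g h w \<longleftrightarrow>
     (\<forall>x\<in>{a..b}. C_k_on 2 {0..T} (\<lambda>s. w s x)) \<and>
     (\<forall>t\<in>{0..T}. C_k_on 2 {a..b} (w t)) \<and>
     (\<forall>k\<le>2. continuous_on ({0..T} \<times> {a..b}) (\<lambda>(t, x). (deriv_on {0..T} ^^ k) (\<lambda>s. w s x) t)) \<and>
     (\<forall>k\<le>2. continuous_on ({0..T} \<times> {a..b}) (\<lambda>(t, x). (deriv_on {a..b} ^^ k) (w t) x)) \<and>
     (\<forall>t\<in>{0..T}. \<forall>x\<in>{a..b}.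
        \<rho> * (deriv_on {0..T} ^^ 2) (\<lambda>s. w s x) t = Y * (deriv_on {a..b} ^^ 2) (w t) x + body t x) \<and>
     (\<forall>t\<in>{0..T}. \<forall>x\<in>{a, b}. w t x = 0 \<and> deriv_on {0..T} (\<lambda>s. w s x) t = 0) \<and>
     (\<forall>t\<in>{0..T}. \<forall>x. x \<notin> {a..b} \<longrightarrow> w t x = 0) \<and>
     initial_data a b T g h w"

definition error_energy ::
    "real \<Rightarrow> real \<Rightarrow> real \<Rightarrow> real \<Rightarrow> real \<Rightarrow> (real \<Rightarrow> real \<Rightarrow> real) \<Rightarrow> real \<Rightarrow> real" where
  "error_energy a b T \<rho> Y e t =
     integral {a..b} (\<lambda>x. \<rho> * \<bar>deriv_on {0..T} (\<lambda>s. e s x) t\<bar>\<^sup>2) +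
     integral {a..b} (\<lambda>x. Y * \<bar>deriv_on {a..b} (e t) x\<bar>\<^sup>2)"

definition H1_norm :: "real \<Rightarrow> real \<Rightarrow> (real \<Rightarrow> real) \<Rightarrow> real" where
  "H1_norm a b v =
     sqrt (integral {a..b} (\<lambda>x. \<bar>v x\<bar>\<^sup>2) + integral {a..b} (\<lambda>x. \<bar>deriv_on {a..b} v x\<bar>\<^sup>2))"

end

theory Submission
  imports Defs
begin

text \<open>
  The error \<open>e\<close> between the nonlocal and the local displacement solves a wave equation
  \<open>\<rho> e\<^sub>t\<^sub>t = Y e\<^sub>x\<^sub>x + r\<close> with zero initial and boundary data, where \<open>Y\<close> is Young's modulus and the
  residual \<open>r\<close> is the difference between the peridynamic force and \<open>Y w\<^sub>x\<^sub>x\<close>, for \<open>w\<close> the nonlocal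
  displacement. The theorem is consistency (\<open>r\<close> is of order \<open>\<epsilon>\<^sup>2\<close>) plus stability (the energy of a
  wave is controlled by its source).

  Consistency. Since \<open>w\<close> vanishes in a layer around the endpoints, its extension by zero is \<open>C\<^sup>4\<close> on
  the line with the same bound on the fourth derivative (locale \<open>layer_displacement\<close>). Rescaling the
  horizon and pairing opposite bonds writes the force as an average of second differences
  \<open>w(x + \<epsilon>z) - 2 w(x) + w(x - \<epsilon>z)\<close> over \<open>z \<in> [-1,1]\<close>, with a weight whose total mass is exactly \<open>Y\<close>.
  Taylor's formula replaces the second difference by \<open>\<epsilon>\<^sup>2z\<^sup>2w\<^sub>x\<^sub>x\<close> up to \<open>C\<^sub>1\<epsilon>\<^sup>4z\<^sup>4/12\<close>, whence
  \<open>\<bar>r\<bar> \<le> Y C\<^sub>1 \<epsilon>\<^sup>2 / 12\<close> (lemma \<open>peridynamic_force_consistency\<close>).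

  Stability. The usual computation of \<open>d/dt \<integral> \<rho> e\<^sub>t\<^sup>2 + Y e\<^sub>x\<^sup>2 = 2 \<integral> e\<^sub>t r\<close> differentiates \<open>e\<^sub>x\<close> in time,
  whereas solutions may have no mixed derivative. The identity survives: an increment of \<open>\<integral> e\<^sub>x\<^sup>2\<close> is
  a difference of squares, and integrating it by parts in space before dividing by the time step
  moves the difference quotient in time onto \<open>e\<close> (lemmas \<open>elastic_energy_increment\<close> and
  \<open>elastic_energy_has_derivative\<close>). Gronwall's argument then bounds the energy by a multiple of
  \<open>\<epsilon>\<^sup>4\<close>, and Poincare's inequality turns this into the rate in the \<open>H\<^sup>1\<close> norm.

  The energy identity needs \<open>e\<^sub>t\<close>, \<open>e\<^sub>t\<^sub>t\<close>, \<open>e\<^sub>x\<close> and \<open>e\<^sub>x\<^sub>x\<close> to be jointly continuous, while \<open>w\<close> is only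
  given as regular in each variable separately. The fourth derivative bound provides the missing
  uniformity: it makes \<open>w\<close>, \<open>w\<^sub>x\<close>, \<open>w\<^sub>x\<^sub>x\<close> and the force Lipschitz in space uniformly in time, and
  a function that is uniformly Lipschitz in one variable and continuous in the other is jointly
  continuous. Continuity in time passes from a function to its space derivative because the bound
  makes difference quotients in space converge uniformly in time (lemma
  \<open>derivative_continuous_on_prod_if_uniformly_Lipschitz\<close>). The equation then yields \<open>w\<^sub>t\<^sub>t\<close>, and the
  same lemma with time and space exchanged yields \<open>w\<^sub>t\<close>.
\<close>

section \<open>One-sided derivatives and extension by zero\<close>

lemma deriv_on_eqI:
  assumes "a < b" and "x \<in> {a..b}" and "(v has_real_derivative d) (at x within {a..b})"
  shows "deriv_on {a..b} v x = d"
  unfolding deriv_on_def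
  using assms vector_derivative_within_closed_interval
  by (simp add: has_real_derivative_iff_has_vector_derivative)

lemma C_k_on_has_real_derivative:
  assumes "C_k_on k S v" and "j < k" and "x \<in> S"
  shows "((deriv_on S ^^ j) v has_real_derivative (deriv_on S ^^ Suc j) v x) (at x within S)"
proof -
  have "(deriv_on S ^^ j) v differentiable (at x within S)"
    using assms by (auto simp: C_k_on_def differentiable_on_def)
  then show ?thesis
    by (simp add: deriv_on_def vector_derivative_works
        has_real_derivative_iff_has_vector_derivative)
qed

lemma C_k_on_imp_continuous_on_iterate:
  assumes "C_k_on k S v" and "j \<le> k"
  shows "continuous_on S ((deriv_on S ^^ j) v)"
proof (cases "j = k")
  case True
  then show ?thesis using assms by (simp add: C_k_on_def)
next
  case False
  then show ?thesis
    using assms by (auto simp: C_k_on_def intro!: differentiable_imp_continuous_on)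
qed

lemma iterated_deriv_on_eq_0:
  assumes "a < b" and "open U" and "\<And>x. x \<in> U \<inter> {a..b} \<Longrightarrow> v x = 0"
    and "x \<in> U \<inter> {a..b}"
  shows "(deriv_on {a..b} ^^ j) v x = 0"
  using \<open>x \<in> U \<inter> {a..b}\<close>
proof (induction j arbitrary: x)
  case 0
  then show ?case using assms(3) by simp
next
  case (Suc j)
  obtain d where d: "d > 0" "ball x d \<subseteq> U"
    using \<open>open U\<close> Suc.prems by (auto elim: openE)
  have "((\<lambda>_. 0) has_real_derivative 0) (at x within {a..b})"
    by simp
  then have "((deriv_on {a..b} ^^ j) v has_real_derivative 0) (at x within {a..b})"
    by (rule has_field_derivative_transform_within[OF _ \<open>d > 0\<close>])
      (use Suc d in \<open>force simp: dist_commute\<close>)+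
  then show ?case
    using deriv_on_eqI[OF \<open>a < b\<close>] Suc.prems by auto
qed

definition zero_extension :: "real \<Rightarrow> real \<Rightarrow> (real \<Rightarrow> real) \<Rightarrow> real \<Rightarrow> real" where
  "zero_extension a b v x = (if x \<in> {a..b} then v x else 0)"

text \<open>Because \<open>v\<close> vanishes on a neighbourhood \<open>U\<close> of both endpoints, the extension is locally
  constant wherever the derivative of \<open>v\<close> is only one-sided.\<close>

lemma zero_extension_has_real_derivative:
  assumes "a < b" and "open U" and "a \<in> U" and "b \<in> U"
    and vanish: "\<And>x. x \<in> U \<inter> {a..b} \<Longrightarrow> v x = 0"
    and der: "\<And>x. x \<in> {a..b} \<Longrightarrow> (v has_real_derivative v' x) (at x within {a..b})"
  shows "(zero_extension a b v has_real_derivative zero_extension a b v' x) (at x)"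
proof (cases "x \<in> {a<..<b}")
  case True
  then have "(v has_real_derivative v' x) (at x)"
    using der[of x] at_within_Icc_at[of a x b] by simp
  then have "(zero_extension a b v has_real_derivative v' x) (at x)"
    by (rule has_field_derivative_transform_within_open[where S = "{a<..<b}"])
      (use True in \<open>auto simp: zero_extension_def\<close>)
  then show ?thesis using True by (simp add: zero_extension_def)
next
  case False
  \<comment> \<open>The extension vanishes on this open set, which covers everything but the interior.\<close>
  let ?N = "U \<union> - {a..b}"
  have N: "open ?N" "x \<in> ?N"
    using False assms by (auto simp: not_less intro: antisym)
  have "((\<lambda>_. 0) has_real_derivative 0) (at x)"
    by simp
  then have *: "(zero_extension a b v has_real_derivative 0) (at x)"
    by (rule has_field_derivative_transform_within_open[OF _ N])
      (use vanish in \<open>auto simp: zero_extension_def\<close>)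
  moreover have "zero_extension a b v' x = 0"
  proof (cases "x \<in> {a..b}")
    case True
    have "((zero_extension a b v) has_real_derivative 0) (at x within {a..b})"
      using * by (rule has_field_derivative_at_within)
    then have "(v has_real_derivative 0) (at x within {a..b})"
      by (rule has_field_derivative_transform_within[OF _ zero_less_one])
        (use True in \<open>auto simp: zero_extension_def\<close>)
    then have "v' x = 0"
      using deriv_on_eqI[OF \<open>a < b\<close> True] der[OF True] by metis
    then show ?thesis by (simp add: zero_extension_def)
  qed (auto simp: zero_extension_def)
  ultimately show ?thesis by simp
qed

lemma real_derivative_bound_imp_Lipschitz:
  fixes f :: "real \<Rightarrow> real"
  assumes "convex S" and "\<And>x. x \<in> S \<Longrightarrow> (f has_real_derivative f' x) (at x within S)"
    and "\<And>x. x \<in> S \<Longrightarrow> \<bar>f' x\<bar> \<le> B" and "x \<in> S" and "y \<in> S"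
  shows "\<bar>f x - f y\<bar> \<le> B * \<bar>x - y\<bar>"
  using field_differentiable_bound[of S f f' B x y] assms by auto

lemma open_nonlocal_boundary: "open (nonlocal_boundary a b \<epsilon>)"
  by (auto simp: nonlocal_boundary_def)

text \<open>A displacement of class \<open>C\<^sup>4\<close> that vanishes in the boundary layer. Its extension by zero is of
  class \<open>C\<^sup>4\<close> on the whole line because the layer is a neighbourhood of both endpoints, and a
  bound on the fourth derivative bounds all lower ones because these vanish at the left
  endpoint.\<close>

locale layer_displacement =
  fixes a b \<epsilon> B :: real and v :: "real \<Rightarrow> real"
  assumes ab: "a < b" and eps: "\<epsilon> > 0"
    and C4: "C_k_on 4 {a..b} v"
    and layer: "\<And>x. x \<in> nonlocal_boundary a b \<epsilon> \<Longrightarrow> v x = 0"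
    and fourth: "\<And>x. x \<in> {a..b} \<Longrightarrow> \<bar>(deriv_on {a..b} ^^ 4) v x\<bar> \<le> B"
begin

definition V :: "nat \<Rightarrow> real \<Rightarrow> real" where
  "V j = zero_extension a b ((deriv_on {a..b} ^^ j) v)"

lemma V_inside: "x \<in> {a..b} \<Longrightarrow> V j x = (deriv_on {a..b} ^^ j) v x"
  by (simp add: V_def zero_extension_def)

lemma V_outside: "x \<notin> {a..b} \<Longrightarrow> V j x = 0"
  by (auto simp: V_def zero_extension_def)

lemma V_layer: "x \<in> nonlocal_boundary a b \<epsilon> \<Longrightarrow> V j x = 0"
  using iterated_deriv_on_eq_0[OF ab open_nonlocal_boundary, of a b \<epsilon> v x j] layer
  by (simp add: V_def zero_extension_def)

lemma V_has_real_derivative: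
  assumes "j < 4"
  shows "(V j has_real_derivative V (Suc j) x) (at x)"
  unfolding V_def
proof (rule zero_extension_has_real_derivative[OF ab])
  show "open (nonlocal_boundary a b \<epsilon>)"
    by (rule open_nonlocal_boundary)
  show "a \<in> nonlocal_boundary a b \<epsilon>" "b \<in> nonlocal_boundary a b \<epsilon>"
    using eps by (auto simp: nonlocal_boundary_def)
  show "(deriv_on {a..b} ^^ j) v y = 0" if "y \<in> nonlocal_boundary a b \<epsilon> \<inter> {a..b}" for y
    using V_layer[of y j] V_inside[of y j] that by auto
  show "((deriv_on {a..b} ^^ j) v has_real_derivative (deriv_on {a..b} ^^ Suc j) v y)
      (at y within {a..b})" if "y \<in> {a..b}" for y
    using C_k_on_has_real_derivative[OF C4 assms that] .
qed

lemma B_nonneg: "0 \<le> B"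
  using fourth[of a] ab abs_ge_zero[of "(deriv_on {a..b} ^^ 4) v a"] by simp

lemma V_bound:
  assumes "j \<le> 4"
  shows "\<bar>V j x\<bar> \<le> B * (b - a) ^ (4 - j)"
  using assms
proof (induction arbitrary: x rule: inc_induct)
  case base
  then show ?case
    using fourth[of x] B_nonneg by (auto simp: V_def zero_extension_def)
next
  case (step j)
  define K where "K = B * (b - a) ^ (4 - Suc j)"
  have K: "0 \<le> K"
    using B_nonneg ab by (simp add: K_def)
  have K_eq: "B * (b - a) ^ (4 - j) = K * (b - a)"
  proof -
    have "4 - j = Suc (4 - Suc j)"
      using step.hyps by simp
    then show ?thesis
      by (simp only: K_def power_Suc mult_ac)
  qed
  show ?case
  proof (cases "x \<in> {a..b}")
    case True
    have "\<bar>V j x - V j a\<bar> \<le> K * \<bar>x - a\<bar>"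
      by (rule real_derivative_bound_imp_Lipschitz[of UNIV _ "V (Suc j)"])
        (use step V_has_real_derivative[of j] in \<open>auto simp: K_def\<close>)
    moreover have "V j a = 0"
      using V_layer[of a j] eps by (simp add: nonlocal_boundary_def)
    moreover have "K * \<bar>x - a\<bar> \<le> K * (b - a)"
      using True K by (intro mult_left_mono) auto
    ultimately show ?thesis
      by (simp add: K_eq)
  next
    case False
    then show ?thesis
      using V_outside K ab K_eq by simp
  qed
qed

lemma V_Lipschitz:
  assumes "j < 4"
  shows "\<bar>V j x - V j y\<bar> \<le> B * (b - a) ^ (3 - j) * \<bar>x - y\<bar>"
proof (rule real_derivative_bound_imp_Lipschitz[of UNIV _ "V (Suc j)"])
  show "\<bar>V (Suc j) z\<bar> \<le> B * (b - a) ^ (3 - j)" for z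
    using V_bound[of "Suc j" z] assms by (simp add: numeral_eq_Suc)
qed (use V_has_real_derivative[OF assms] in auto)

end

section \<open>The peridynamic force as an average of second differences\<close>

definition second_difference :: "(real \<Rightarrow> real) \<Rightarrow> real \<Rightarrow> real \<Rightarrow> real" where
  "second_difference W h x = W (x + h) - 2 * W x + W (x - h)"

lemma second_difference_bound:
  assumes "\<And>j x. j < 2 \<Longrightarrow> (W j has_real_derivative W (Suc j) x) (at x)"
    and "\<And>x. \<bar>W 2 x\<bar> \<le> B"
  shows "\<bar>second_difference (W 0) h x\<bar> \<le> B * h\<^sup>2"
proof -
  have taylor: "\<exists>s. W 0 (x + k) = W 0 x + k * W 1 x + k\<^sup>2 / 2 * W 2 s" for k
  proof -
    have "\<exists>t. \<bar>t\<bar> \<le> \<bar>k\<bar> \<and> W 0 (x + k) = (\<Sum>m<2. W m (x + 0) / fact m * k ^ m) + W 2 (x + t) / fact 2 * k ^ 2"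
      by (rule Maclaurin_bi_le[where diff = "\<lambda>m t. W m (x + t)"])
        (use assms(1) in \<open>auto simp: add.commute[of x] simp flip: DERIV_shift\<close>)
    then show ?thesis
      by (auto simp: numeral_2_eq_2 field_simps)
  qed
  obtain s where s: "W 0 (x + h) = W 0 x + h * W 1 x + h\<^sup>2 / 2 * W 2 s"
    using taylor by blast
  obtain t where t: "W 0 (x - h) = W 0 x - h * W 1 x + h\<^sup>2 / 2 * W 2 t"
    using taylor[of "- h"] by auto
  have "second_difference (W 0) h x = (W 2 s + W 2 t) / 2 * h\<^sup>2"
    unfolding second_difference_def s t by (simp add: field_simps)
  moreover have "\<bar>(W 2 s + W 2 t) / 2\<bar> \<le> B"
    using assms(2)[of s] assms(2)[of t] abs_triangle_ineq[of "W 2 s" "W 2 t"] by simp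
  ultimately show ?thesis
    by (simp only: abs_mult) (rule mult_mono, simp_all)
qed

text \<open>The symmetry of the two bonds cancels the odd Taylor terms, so the error is of fourth
  order.\<close>

lemma second_difference_consistency:
  assumes "\<And>j x. j < 4 \<Longrightarrow> (W j has_real_derivative W (Suc j) x) (at x)"
    and "\<And>x. \<bar>W 4 x\<bar> \<le> B"
  shows "\<bar>second_difference (W 0) h x - h\<^sup>2 * W 2 x\<bar> \<le> B / 12 * h ^ 4"
proof -
  have taylor: "\<exists>s. W 0 (x + k) = W 0 x + k * W 1 x + k\<^sup>2 / 2 * W 2 x + k ^ 3 / 6 * W 3 x + k ^ 4 / 24 * W 4 s" for k
  proof -
    have "\<exists>t. \<bar>t\<bar> \<le> \<bar>k\<bar> \<and> W 0 (x + k) = (\<Sum>m<4. W m (x + 0) / fact m * k ^ m) + W 4 (x + t) / fact 4 * k ^ 4"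
      by (rule Maclaurin_bi_le[where diff = "\<lambda>m t. W m (x + t)"])
        (use assms(1) in \<open>auto simp: add.commute[of x] simp flip: DERIV_shift\<close>)
    then show ?thesis
      by (auto simp: eval_nat_numeral field_simps)
  qed
  obtain s where s: "W 0 (x + h) = W 0 x + h * W 1 x + h\<^sup>2 / 2 * W 2 x + h ^ 3 / 6 * W 3 x + h ^ 4 / 24 * W 4 s"
    using taylor by blast
  obtain t where t: "W 0 (x - h) = W 0 x - h * W 1 x + h\<^sup>2 / 2 * W 2 x - h ^ 3 / 6 * W 3 x + h ^ 4 / 24 * W 4 t"
    using taylor[of "- h"] by auto
  have "second_difference (W 0) h x - h\<^sup>2 * W 2 x = (W 4 s + W 4 t) / 24 * h ^ 4"
    unfolding second_difference_def s t by (simp add: field_simps)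
  moreover have "\<bar>(W 4 s + W 4 t) / 24\<bar> \<le> B / 12"
    using assms(2)[of s] assms(2)[of t] abs_triangle_ineq[of "W 4 s" "W 4 t"] by simp
  ultimately show ?thesis
    by (simp only: abs_mult) (rule mult_mono, simp_all)
qed

lemma borel_measurable_on_interval:
  "continuous_on {-1..1} h \<Longrightarrow> h \<in> borel_measurable (lebesgue_on {-1..1::real})"
  for h :: "real \<Rightarrow> real"
  by (rule continuous_imp_measurable_on_sets_lebesgue) auto

lemma second_difference_quotient_measurable:
  assumes "continuous_on UNIV W"
  shows "(\<lambda>z. second_difference W (\<epsilon> * z) x / z\<^sup>2) \<in> borel_measurable (lebesgue_on {-1..1})"
proof (rule borel_measurable_divide)
  show "(\<lambda>z. second_difference W (\<epsilon> * z) x) \<in> borel_measurable (lebesgue_on {-1..1})"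
    unfolding second_difference_def
    by (intro borel_measurable_on_interval continuous_intros continuous_on_compose2[OF assms]) auto
  show "(\<lambda>z::real. z\<^sup>2) \<in> borel_measurable (lebesgue_on {-1..1})"
    by (intro borel_measurable_on_interval continuous_intros)
qed

text \<open>The density of Young's modulus, which turns out to be the averaging weight in the force.\<close>

definition bond_weight :: "(real \<Rightarrow> real) \<Rightarrow> (real \<Rightarrow> real) \<Rightarrow> real \<Rightarrow> real" where
  "bond_weight f J z = J \<bar>z\<bar> * deriv_on {0..} f 0 * \<bar>z\<bar>"

locale peridynamic_material =
  fixes f J :: "real \<Rightarrow> real" and M :: real
  assumes influence: "influence_function M J"
    and modulus_pos: "youngs_modulus f J > 0"
begin

abbreviation "Y \<equiv> youngs_modulus f J"

lemma influence_nonneg: "0 \<le> J \<bar>z\<bar>"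
  using influence by (cases "z \<in> {-1..1}") (auto simp: influence_function_def)

lemma influence_measurable: "(\<lambda>z. J \<bar>z\<bar>) \<in> borel_measurable (lebesgue_on {-1..1})"
  using influence by (auto simp: influence_function_def intro: measurable_restrict_space1)

lemma influence_integrable:
  assumes "\<phi> \<in> borel_measurable (lebesgue_on {-1..1})" and "\<And>z. z \<in> {-1..1} \<Longrightarrow> \<bar>\<phi> z\<bar> \<le> B"
  shows "(\<lambda>z. J \<bar>z\<bar> * \<phi> z) integrable_on {-1..1}"
proof (rule measurable_bounded_by_integrable_imp_integrable)
  show "(\<lambda>z. J \<bar>z\<bar> * \<phi> z) \<in> borel_measurable (lebesgue_on {-1..1})"
    using influence_measurable assms(1) by (rule borel_measurable_times)
  show "(\<lambda>_::real. M * B) integrable_on {-1..1}"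
    by (rule integrable_const_ivl)
  show "norm (J \<bar>z\<bar> * \<phi> z) \<le> M * B" if "z \<in> {-1..1}" for z
  proof -
    have "J \<bar>z\<bar> * \<bar>\<phi> z\<bar> \<le> M * B"
      using influence that assms(2)[OF that] influence_nonneg[of z]
      by (intro mult_mono) (auto simp: influence_function_def)
    then show ?thesis
      using influence_nonneg[of z] by (simp add: abs_mult)
  qed
qed simp

text \<open>The influence function is nonnegative, so the sign of the modulus is that of \<open>f'(0)\<close>.\<close>

lemma stiffness_pos: "deriv_on {0..} f 0 > 0"
proof (rule ccontr)
  assume "\<not> ?thesis"
  then have neg: "bond_weight f J z \<le> 0" for z
    using influence_nonneg[of z]
    by (simp add: bond_weight_def mult_nonneg_nonpos mult_nonpos_nonneg)
  have "integral {-1..1} (bond_weight f J) > 0"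
    using modulus_pos by (simp add: youngs_modulus_def bond_weight_def[abs_def])
  \<comment> \<open>The integral of a function that is not integrable is 0 by convention.\<close>
  moreover from this have "bond_weight f J integrable_on {-1..1}"
    using not_integrable_integral by fastforce
  then have "integral {-1..1} (bond_weight f J) \<le> integral {-1..1} (\<lambda>_::real. 0)"
    by (rule integral_le) (use neg in auto)
  ultimately show False
    by simp
qed

lemma bond_weight_nonneg: "0 \<le> bond_weight f J z"
  using influence_nonneg[of z] stiffness_pos by (simp add: bond_weight_def)

text \<open>The weight vanishes at \<open>z = 0\<close>, so a bound away from the origin suffices. This matters for
  second difference quotients, whose value at \<open>z = 0\<close> is the meaningless \<open>0 / 0 = 0\<close>.\<close>

lemma bond_weight_integrable:
  assumes "\<phi> \<in> borel_measurable (lebesgue_on {-1..1})"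
    and bound: "\<And>z. z \<in> {-1..1} \<Longrightarrow> z \<noteq> 0 \<Longrightarrow> \<bar>\<phi> z\<bar> \<le> B"
  shows "(\<lambda>z. bond_weight f J z * \<phi> z) integrable_on {-1..1}"
proof -
  have "(\<lambda>z. J \<bar>z\<bar> * (deriv_on {0..} f 0 * (\<bar>z\<bar> * \<phi> z))) integrable_on {-1..1}"
  proof (rule influence_integrable)
    have [measurable]: "(\<lambda>z::real. \<bar>z\<bar>) \<in> borel_measurable (lebesgue_on {-1..1})"
      by (intro borel_measurable_on_interval continuous_intros)
    show "(\<lambda>z. deriv_on {0..} f 0 * (\<bar>z\<bar> * \<phi> z)) \<in> borel_measurable (lebesgue_on {-1..1})"
      using assms(1) by measurable
    show "\<bar>deriv_on {0..} f 0 * (\<bar>z\<bar> * \<phi> z)\<bar> \<le> deriv_on {0..} f 0 * B" if "z \<in> {-1..1}" for z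
    proof -
      have "\<bar>z\<bar> * \<bar>\<phi> z\<bar> \<le> 1 * B"
      proof (cases "z = 0")
        case True
        then show ?thesis
          using bound[of 1] by simp
      next
        case False
        then show ?thesis
          using bound[of z] that by (intro mult_mono) auto
      qed
      then show ?thesis
        using stiffness_pos by (simp add: abs_mult)
    qed
  qed
  then show ?thesis
    by (simp add: bond_weight_def mult.assoc)
qed

lemma bond_weight_average_bound:
  assumes "\<phi> \<in> borel_measurable (lebesgue_on {-1..1})"
    and "\<And>z. z \<in> {-1..1} \<Longrightarrow> z \<noteq> 0 \<Longrightarrow> \<bar>\<phi> z\<bar> \<le> B"
  shows "\<bar>integral {-1..1} (\<lambda>z. bond_weight f J z * \<phi> z)\<bar> \<le> Y * B"
proof -
  have "norm (integral {-1..1} (\<lambda>z. bond_weight f J z * \<phi> z))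
      \<le> integral {-1..1} (\<lambda>z. bond_weight f J z * B)"
  proof (rule integral_norm_bound_integral)
    show "(\<lambda>z. bond_weight f J z * \<phi> z) integrable_on {-1..1}"
      using assms by (rule bond_weight_integrable)
    show "(\<lambda>z. bond_weight f J z * B) integrable_on {-1..1}"
      by (rule bond_weight_integrable[where B = "\<bar>B\<bar>"]) auto
    show "norm (bond_weight f J z * \<phi> z) \<le> bond_weight f J z * B" if "z \<in> {-1..1}" for z
      using assms(2)[OF that] bond_weight_nonneg[of z]
      by (cases "z = 0") (auto simp: bond_weight_def[of f J 0] abs_mult mult_left_mono)
  qed
  then show ?thesis
    by (simp add: youngs_modulus_def bond_weight_def)
qed

text \<open>Rescaling the horizon to \<open>[-1,1]\<close> and pairing the bond \<open>z\<close> with \<open>-z\<close>. The displacement is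
  only compared with \<open>W\<close> in the open horizon: at the two ends of the bond range it may be
  arbitrary.\<close>

lemma peridynamic_force_eq_second_differences:
  assumes "\<epsilon> > 0" and "continuous_on UNIV W" and Lip: "\<And>y. \<bar>W y - W x\<bar> \<le> L * \<bar>y - x\<bar>"
    and v: "\<And>y. y \<in> {x - \<epsilon><..<x + \<epsilon>} \<Longrightarrow> v y = W y"
  shows "peridynamic_force f J \<epsilon> v x =
    1 / \<epsilon>\<^sup>2 * integral {-1..1} (\<lambda>z. bond_weight f J z * (second_difference W (\<epsilon> * z) x / z\<^sup>2))"
proof -
  define c where "c = deriv_on {0..} f 0"
  define bond where "bond y = J (\<bar>y - x\<bar> / \<epsilon>) * c * strain y x W" for y
  define g where "g z = J \<bar>z\<bar> * (c * ((W (x + \<epsilon> * z) - W x) / \<bar>z\<bar>))" for z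
  have g: "g integrable_on {-1..1}"
    unfolding g_def
  proof (rule influence_integrable)
    have [measurable]: "(\<lambda>z. W (x + \<epsilon> * z)) \<in> borel_measurable (lebesgue_on {-1..1})"
      "(\<lambda>z::real. \<bar>z\<bar>) \<in> borel_measurable (lebesgue_on {-1..1})"
      by (intro borel_measurable_on_interval continuous_intros
          continuous_on_compose2[OF \<open>continuous_on UNIV W\<close>]; simp)+
    show "(\<lambda>z. c * ((W (x + \<epsilon> * z) - W x) / \<bar>z\<bar>)) \<in> borel_measurable (lebesgue_on {-1..1})"
      by measurable
    show "\<bar>c * ((W (x + \<epsilon> * z) - W x) / \<bar>z\<bar>)\<bar> \<le> c * (\<bar>L\<bar> * \<epsilon>)" for z
    proof -
      have "\<bar>W (x + \<epsilon> * z) - W x\<bar> \<le> \<bar>L\<bar> * \<epsilon> * \<bar>z\<bar>"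
      proof -
        have "\<bar>W (x + \<epsilon> * z) - W x\<bar> \<le> L * \<bar>\<epsilon> * z\<bar>"
          using Lip[of "x + \<epsilon> * z"] by simp
        also have "\<dots> \<le> \<bar>L\<bar> * \<bar>\<epsilon> * z\<bar>"
          by (rule mult_right_mono) auto
        finally show ?thesis
          using \<open>\<epsilon> > 0\<close> by (simp add: abs_mult mult.assoc)
      qed
      then have "\<bar>(W (x + \<epsilon> * z) - W x) / \<bar>z\<bar>\<bar> \<le> \<bar>L\<bar> * \<epsilon>"
        using \<open>\<epsilon> > 0\<close> by (cases "z = 0") (simp_all add: divide_le_eq)
      then show ?thesis
        using stiffness_pos unfolding abs_mult[of c] by (simp add: c_def del: abs_divide)
    qed
  qed
  have "(g has_integral integral {-1..1} g) {-1..1}"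
    using g by (rule integrable_integral)
  then have "((\<lambda>z. g z / \<epsilon>) has_integral integral {-1..1} g / \<epsilon>) {-1..1}"
    by (rule has_integral_divide)
  moreover have "bond (\<epsilon> * z + x) = g z / \<epsilon>" for z
    using \<open>\<epsilon> > 0\<close> by (simp add: bond_def g_def strain_def abs_mult add.commute mult_ac)
  ultimately have "(bond has_integral integral {-1..1} g) {x - \<epsilon>..x + \<epsilon>}"
    using has_integral_affinity_iff[OF \<open>\<epsilon> > 0\<close>, of bond x "integral {-1..1} g" "x - \<epsilon>" "x + \<epsilon>"] \<open>\<epsilon> > 0\<close>
    by (simp add: divide_inverse_commute)
  moreover have "integral {x - \<epsilon>..x + \<epsilon>} (\<lambda>y. J (\<bar>y - x\<bar> / \<epsilon>) * c * strain y x v)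
      = integral {x - \<epsilon>..x + \<epsilon>} bond"
    by (rule integral_spike[of "{x - \<epsilon>, x + \<epsilon>}"])
      (use v \<open>\<epsilon> > 0\<close> in \<open>auto simp: bond_def strain_def\<close>)
  ultimately have force: "peridynamic_force f J \<epsilon> v x = 2 / \<epsilon>\<^sup>2 * integral {-1..1} g"
    unfolding peridynamic_force_def c_def[symmetric] by (simp add: integral_unique)
  have "integral {-1..1} (\<lambda>z. g (- z)) = integral {-1..1} g"
    using Henstock_Kurzweil_Integration.integral_reflect_real[of 1 "-1" g] by simp
  moreover have "(\<lambda>z. g (- z)) integrable_on {-1..1}"
    using g Henstock_Kurzweil_Integration.integrable_reflect_real[of g 1 "-1"] by simp
  ultimately have "2 * integral {-1..1} g = integral {-1..1} (\<lambda>z. g z + g (- z))"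
    using g by (simp add: integral_add)
  also have "(\<lambda>z. g z + g (- z)) = (\<lambda>z. bond_weight f J z * (second_difference W (\<epsilon> * z) x / z\<^sup>2))"
  proof
    show "g z + g (- z) = bond_weight f J z * (second_difference W (\<epsilon> * z) x / z\<^sup>2)" for z
    proof (cases "z = 0")
      case False
      have cancel: "r * (s / (r * r)) = s / r" if "r \<noteq> 0" for r s :: real
        using that by simp
      have square: "z\<^sup>2 = \<bar>z\<bar> * \<bar>z\<bar>"
        by (simp add: power2_eq_square)
      have "\<bar>z\<bar> * (second_difference W (\<epsilon> * z) x / z\<^sup>2) = second_difference W (\<epsilon> * z) x / \<bar>z\<bar>"
        unfolding square using False by (intro cancel) simp
      moreover have "second_difference W (\<epsilon> * z) x = (W (x + \<epsilon> * z) - W x) + (W (x - \<epsilon> * z) - W x)"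
        by (simp add: second_difference_def)
      ultimately have "\<bar>z\<bar> * (second_difference W (\<epsilon> * z) x / z\<^sup>2)
          = (W (x + \<epsilon> * z) - W x) / \<bar>z\<bar> + (W (x - \<epsilon> * z) - W x) / \<bar>z\<bar>"
        by (simp only: add_divide_distrib)
      then show ?thesis
        by (simp only: g_def bond_weight_def c_def[symmetric] mult.assoc)
          (simp add: distrib_left)
    qed (simp add: g_def bond_weight_def)
  qed
  finally show ?thesis
    unfolding force by simp
qed

lemma peridynamic_force_consistency:
  assumes "\<epsilon> > 0" and der: "\<And>j x. j < 4 \<Longrightarrow> (W j has_real_derivative W (Suc j) x) (at x)"
    and fourth: "\<And>x. \<bar>W 4 x\<bar> \<le> B" and Lip: "\<And>y. \<bar>W 0 y - W 0 x\<bar> \<le> L * \<bar>y - x\<bar>"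
    and v: "\<And>y. y \<in> {x - \<epsilon><..<x + \<epsilon>} \<Longrightarrow> v y = W 0 y"
  shows "\<bar>peridynamic_force f J \<epsilon> v x - Y * W 2 x\<bar> \<le> Y * (B / 12) * \<epsilon>\<^sup>2"
proof -
  have cont: "continuous_on UNIV (W 0)"
    using der[of 0] DERIV_isCont by (force intro: continuous_at_imp_continuous_on)
  define q where "q z = second_difference (W 0) (\<epsilon> * z) x / z\<^sup>2" for z
  have q_meas: "q \<in> borel_measurable (lebesgue_on {-1..1})"
    using second_difference_quotient_measurable[OF cont] by (simp add: q_def[abs_def])
  have "B \<ge> 0"
    using fourth[of x] abs_ge_zero[of "W 4 x"] by linarith
  have q_bound: "\<bar>q z - \<epsilon>\<^sup>2 * W 2 x\<bar> \<le> B / 12 * \<epsilon> ^ 4" if "z \<in> {-1..1}" "z \<noteq> 0" for z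
  proof -
    have "q z - \<epsilon>\<^sup>2 * W 2 x = (second_difference (W 0) (\<epsilon> * z) x - (\<epsilon> * z)\<^sup>2 * W 2 x) / z\<^sup>2"
      using that by (simp add: q_def diff_divide_distrib power_mult_distrib)
    also have "\<bar>\<dots>\<bar> \<le> (B / 12 * (\<epsilon> * z) ^ 4) / z\<^sup>2"
      unfolding abs_divide abs_power2
      using second_difference_consistency[OF der fourth] by (rule divide_right_mono) simp_all
    also have "\<dots> = B / 12 * \<epsilon> ^ 4 * z\<^sup>2"
      using that by (simp add: power_mult_distrib eval_nat_numeral)
    also have "\<dots> \<le> B / 12 * \<epsilon> ^ 4 * 1"
      using that \<open>B \<ge> 0\<close> by (intro mult_left_mono) (auto simp: abs_square_le_1)
    finally show ?thesis by simp
  qed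
  have q_bound': "\<bar>q z\<bar> \<le> B / 12 * \<epsilon> ^ 4 + \<epsilon>\<^sup>2 * \<bar>W 2 x\<bar>" if "z \<in> {-1..1}" "z \<noteq> 0" for z
    using q_bound[OF that] abs_triangle_ineq[of "q z - \<epsilon>\<^sup>2 * W 2 x" "\<epsilon>\<^sup>2 * W 2 x"]
    by (simp add: abs_mult)
  have const: "(\<lambda>z. bond_weight f J z * k) integrable_on {-1..1}" for k
    by (rule bond_weight_integrable[where B = "\<bar>k\<bar>"]) auto
  have force: "peridynamic_force f J \<epsilon> v x
      = 1 / \<epsilon>\<^sup>2 * integral {-1..1} (\<lambda>z. bond_weight f J z * q z)"
    unfolding q_def by (rule peridynamic_force_eq_second_differences[OF \<open>\<epsilon> > 0\<close> cont Lip v])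
  have local_force: "Y * W 2 x = 1 / \<epsilon>\<^sup>2 * integral {-1..1} (\<lambda>z. bond_weight f J z * (\<epsilon>\<^sup>2 * W 2 x))"
    using \<open>\<epsilon> > 0\<close> by (simp add: youngs_modulus_def bond_weight_def)
  have "integral {-1..1} (\<lambda>z. bond_weight f J z * q z)
      - integral {-1..1} (\<lambda>z. bond_weight f J z * (\<epsilon>\<^sup>2 * W 2 x))
      = integral {-1..1} (\<lambda>z. bond_weight f J z * (q z - \<epsilon>\<^sup>2 * W 2 x))"
    unfolding right_diff_distrib[of "bond_weight f J _"]
    by (rule Henstock_Kurzweil_Integration.integral_diff[symmetric,
          OF bond_weight_integrable[OF q_meas q_bound'] const])
  then have "peridynamic_force f J \<epsilon> v x - Y * W 2 x
      = 1 / \<epsilon>\<^sup>2 * integral {-1..1} (\<lambda>z. bond_weight f J z * (q z - \<epsilon>\<^sup>2 * W 2 x))"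
    unfolding force local_force by (simp only: right_diff_distrib[symmetric])
  also have "\<bar>\<dots>\<bar> \<le> 1 / \<epsilon>\<^sup>2 * (Y * (B / 12 * \<epsilon> ^ 4))"
    unfolding abs_mult
    using bond_weight_average_bound[of "\<lambda>z. q z - \<epsilon>\<^sup>2 * W 2 x", OF _ q_bound] q_meas
    by (intro mult_mono) auto
  also have "\<dots> = Y * (B / 12) * \<epsilon>\<^sup>2"
    using \<open>\<epsilon> > 0\<close> by (simp add: eval_nat_numeral)
  finally show ?thesis .
qed

text \<open>Differentiating a second difference of step \<open>\<epsilon>z\<close> gives a second difference of the derivative,
  which is at most \<open>B (\<epsilon>z)\<^sup>2\<close>. This cancels the singular factor \<open>1 / \<epsilon>\<^sup>2\<close>.\<close>

lemma peridynamic_force_Lipschitz: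
  assumes "\<epsilon> > 0" and der: "\<And>j x. j < 3 \<Longrightarrow> (W j has_real_derivative W (Suc j) x) (at x)"
    and third: "\<And>x. \<bar>W 3 x\<bar> \<le> B" and Lip: "\<And>x y. \<bar>W 0 y - W 0 x\<bar> \<le> L * \<bar>y - x\<bar>"
    and second: "\<And>x. \<bar>W 2 x\<bar> \<le> B2"
    and v: "\<And>z. z \<in> {x - \<epsilon><..<x + \<epsilon>} \<union> {y - \<epsilon><..<y + \<epsilon>} \<Longrightarrow> v z = W 0 z"
  shows "\<bar>peridynamic_force f J \<epsilon> v x - peridynamic_force f J \<epsilon> v y\<bar> \<le> Y * B * \<bar>x - y\<bar>"
proof -
  have cont: "continuous_on UNIV (W 0)"
    using der[of 0] DERIV_isCont by (force intro: continuous_at_imp_continuous_on)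
  define q where "q x z = second_difference (W 0) (\<epsilon> * z) x / z\<^sup>2" for x z
  have q_meas: "q x \<in> borel_measurable (lebesgue_on {-1..1})" for x
    using second_difference_quotient_measurable[OF cont] by (simp add: q_def[abs_def])
  \<comment> \<open>Only the existence of this bound matters: it makes the two averages integrable.\<close>
  have q_bound: "\<bar>q x z\<bar> \<le> B2 * \<epsilon>\<^sup>2" if "z \<noteq> 0" for x z
    using second_difference_bound[of W B2 "\<epsilon> * z" x] der second that
    by (simp add: q_def divide_le_eq power_mult_distrib)
  have q_diff: "\<bar>q x z - q y z\<bar> \<le> B * \<epsilon>\<^sup>2 * \<bar>x - y\<bar>" if "z \<noteq> 0" for z
  proof -
    have "\<bar>second_difference (W 0) (\<epsilon> * z) x - second_difference (W 0) (\<epsilon> * z) y\<bar>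
        \<le> B * (\<epsilon> * z)\<^sup>2 * \<bar>x - y\<bar>"
    proof (rule real_derivative_bound_imp_Lipschitz[of UNIV])
      fix s
      have "((\<lambda>s. W 0 (s + r)) has_real_derivative W 1 (s + r)) (at s)" for r
        using der[of 0 "s + r"] by (simp add: DERIV_shift)
      from this[of "\<epsilon> * z"] this[of 0] this[of "- (\<epsilon> * z)"]
      show "(second_difference (W 0) (\<epsilon> * z) has_real_derivative second_difference (W 1) (\<epsilon> * z) s) (at s)"
        unfolding second_difference_def[abs_def]
        by (auto intro!: derivative_eq_intros)
      show "\<bar>second_difference (W 1) (\<epsilon> * z) s\<bar> \<le> B * (\<epsilon> * z)\<^sup>2"
        using second_difference_bound[of "\<lambda>j. W (Suc j)" B "\<epsilon> * z" s] der third
        by (simp add: numeral_eq_Suc)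
    qed auto
    then show ?thesis
      using that by (simp add: q_def divide_le_eq power_mult_distrib mult_ac flip: diff_divide_distrib)
  qed
  have force: "peridynamic_force f J \<epsilon> v r = 1 / \<epsilon>\<^sup>2 * integral {-1..1} (\<lambda>z. bond_weight f J z * q r z)"
    if "r \<in> {x, y}" for r
    unfolding q_def
    by (rule peridynamic_force_eq_second_differences[OF \<open>\<epsilon> > 0\<close> cont Lip v]) (use that in auto)
  have int: "(\<lambda>z. bond_weight f J z * q r z) integrable_on {-1..1}" for r
    using q_meas q_bound by (rule bond_weight_integrable)
  have "peridynamic_force f J \<epsilon> v x - peridynamic_force f J \<epsilon> v y
      = 1 / \<epsilon>\<^sup>2 * integral {-1..1} (\<lambda>z. bond_weight f J z * (q x z - q y z))"
    using int by (simp add: force right_diff_distrib integral_diff diff_divide_distrib)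
  also have "\<bar>\<dots>\<bar> \<le> 1 / \<epsilon>\<^sup>2 * (Y * (B * \<epsilon>\<^sup>2 * \<bar>x - y\<bar>))"
    unfolding abs_mult
    using bond_weight_average_bound[of "\<lambda>z. q x z - q y z", OF _ q_diff] q_meas
    by (intro mult_mono) auto
  also have "\<dots> = Y * B * \<bar>x - y\<bar>"
    using \<open>\<epsilon> > 0\<close> by simp
  finally show ?thesis .
qed

end

section \<open>Joint continuity of derivatives\<close>

lemma continuous_on_prod_if_uniformly_Lipschitz:
  fixes p :: "real \<Rightarrow> real \<Rightarrow> real"
  assumes cont: "\<And>x. x \<in> X \<Longrightarrow> continuous_on S (\<lambda>t. p t x)"
    and Lip: "\<And>t x y. t \<in> S \<Longrightarrow> x \<in> X \<Longrightarrow> y \<in> X \<Longrightarrow> \<bar>p t x - p t y\<bar> \<le> L * \<bar>x - y\<bar>"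
  shows "continuous_on (S \<times> X) (\<lambda>(t, x). p t x)"
proof (rule continuous_on_TimesI[OF local_lipschitzI cont])
  fix t x assume "t \<in> S" "x \<in> X"
  have "\<bar>L\<bar>-lipschitz_on X (p s)" if "s \<in> S" for s
  proof (rule lipschitz_onI)
    show "dist (p s y) (p s z) \<le> \<bar>L\<bar> * dist y z" if "y \<in> X" "z \<in> X" for y z
      using Lip[OF \<open>s \<in> S\<close> that] mult_right_mono[OF abs_ge_self[of L], of "\<bar>y - z\<bar>"]
      by (simp add: dist_real_def)
  qed simp
  then show "\<exists>u>0. \<exists>L. \<forall>s\<in>cball t u \<inter> S. L-lipschitz_on (cball x u \<inter> X) (p s)"
    by (intro exI[of _ 1] conjI exI[of _ "\<bar>L\<bar>"]) (auto intro: lipschitz_on_subset)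
qed

text \<open>A uniform Lipschitz bound on the derivative makes the difference quotients converge to it
  uniformly in the parameter, so the derivative inherits continuity in the parameter from the
  function.\<close>

lemma derivative_continuous_on_prod_if_uniformly_Lipschitz:
  fixes p :: "real \<Rightarrow> real \<Rightarrow> real"
  assumes "a < b"
    and cont: "\<And>x. x \<in> {a..b} \<Longrightarrow> continuous_on S (\<lambda>t. p t x)"
    and der: "\<And>t x. t \<in> S \<Longrightarrow> x \<in> {a..b} \<Longrightarrow> (p t has_real_derivative p' t x) (at x within {a..b})"
    and Lip: "\<And>t x y. t \<in> S \<Longrightarrow> x \<in> {a..b} \<Longrightarrow> y \<in> {a..b} \<Longrightarrow> \<bar>p' t x - p' t y\<bar> \<le> L * \<bar>x - y\<bar>"
  shows "continuous_on (S \<times> {a..b}) (\<lambda>(t, x). p' t x)"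
proof (rule continuous_on_prod_if_uniformly_Lipschitz[OF _ Lip])
  fix x assume x: "x \<in> {a..b}"
  have quotient: "\<bar>(p t y - p t x) / (y - x) - p' t x\<bar> \<le> \<bar>L\<bar> * \<bar>y - x\<bar>"
    if t: "t \<in> S" and y: "y \<in> {a..b}" "y \<noteq> x" for t y
  proof -
    have "\<bar>(p t y - p' t x * y) - (p t x - p' t x * x)\<bar> \<le> \<bar>L\<bar> * \<bar>y - x\<bar> * \<bar>y - x\<bar>"
    proof (rule real_derivative_bound_imp_Lipschitz)
      let ?S = "closed_segment x y"
      have sub: "?S \<subseteq> {a..b}"
        using x y by (simp add: closed_segment_subset)
      show "((\<lambda>z. p t z - p' t x * z) has_real_derivative p' t z - p' t x) (at z within ?S)"
        if "z \<in> ?S" for z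
        using sub that t
        by (auto intro!: derivative_eq_intros has_field_derivative_subset[OF der])
      show "\<bar>p' t z - p' t x\<bar> \<le> \<bar>L\<bar> * \<bar>y - x\<bar>" if "z \<in> ?S" for z
      proof -
        have "\<bar>p' t z - p' t x\<bar> \<le> L * \<bar>z - x\<bar>"
          using Lip[OF t] sub that x by blast
        also have "\<dots> \<le> \<bar>L\<bar> * \<bar>z - x\<bar>"
          by (rule mult_right_mono) auto
        also have "\<dots> \<le> \<bar>L\<bar> * \<bar>y - x\<bar>"
          using that by (intro mult_left_mono) (auto simp: closed_segment_eq_real_ivl split: if_splits)
        finally show ?thesis .
      qed
    qed auto
    moreover have "(p t y - p t x) / (y - x) - p' t x
        = ((p t y - p' t x * y) - (p t x - p' t x * x)) / (y - x)"
      using y by (simp add: field_simps)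
    ultimately show ?thesis
      using y by (simp only: abs_divide) (simp add: divide_le_eq)
  qed
  have "uniform_limit S (\<lambda>y t. (p t y - p t x) / (y - x)) (\<lambda>t. p' t x) (at x within {a..b})"
  proof (rule uniform_limitI)
    fix e :: real assume "e > 0"
    have "((\<lambda>y. \<bar>L\<bar> * \<bar>y - x\<bar>) \<longlongrightarrow> \<bar>L\<bar> * \<bar>x - x\<bar>) (at x within {a..b})"
      by (intro tendsto_intros)
    then have "\<forall>\<^sub>F y in at x within {a..b}. \<bar>L\<bar> * \<bar>y - x\<bar> < e"
      using \<open>e > 0\<close> order_tendstoD(2)[of _ "\<bar>L\<bar> * \<bar>x - x\<bar>" _ e] by simp
    moreover have "\<forall>\<^sub>F y in at x within {a..b}. y \<in> {a..b} \<and> y \<noteq> x"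
      by (auto simp: eventually_at_filter)
    ultimately show "\<forall>\<^sub>F y in at x within {a..b}. \<forall>t\<in>S. dist ((p t y - p t x) / (y - x)) (p' t x) < e"
    proof eventually_elim
      case (elim y)
      then show ?case
        using quotient[of _ y] by (force simp: dist_real_def)
    qed
  qed
  moreover have "\<forall>\<^sub>F y in at x within {a..b}. continuous_on S (\<lambda>t. (p t y - p t x) / (y - x))"
    unfolding eventually_at_filter using cont x by (auto intro!: always_eventually continuous_intros)
  moreover have "at x within {a..b} \<noteq> bot"
    using x \<open>a < b\<close> islimpt_Icc[of a b x] by (simp add: trivial_limit_within)
  ultimately show "continuous_on S (\<lambda>t. p' t x)"
    by (intro uniform_limit_theorem)
qed

lemma continuous_on_prod_slices:
  assumes "continuous_on (S \<times> X) (\<lambda>(t, x). q t x)"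
  shows "t \<in> S \<Longrightarrow> continuous_on X (q t)" and "x \<in> X \<Longrightarrow> continuous_on S (\<lambda>t. q t x)"
proof -
  show "continuous_on X (q t)" if "t \<in> S"
  proof -
    have "continuous_on X (\<lambda>x. (\<lambda>(t, x). q t x) (t, x))"
      by (rule continuous_on_compose2[OF assms]) (use that in \<open>auto intro!: continuous_intros\<close>)
    then show ?thesis by simp
  qed
  show "continuous_on S (\<lambda>t. q t x)" if "x \<in> X"
  proof -
    have "continuous_on S (\<lambda>t. (\<lambda>(t, x). q t x) (t, x))"
      by (rule continuous_on_compose2[OF assms]) (use that in \<open>auto intro!: continuous_intros\<close>)
    then show ?thesis by simp
  qed
qed

lemma continuous_on_prod_swap:
  assumes "continuous_on (A \<times> B) (\<lambda>(x, y). p x y)"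
  shows "continuous_on (B \<times> A) (\<lambda>(y, x). p x y)"
proof -
  have "continuous_on (B \<times> A) (\<lambda>q. (\<lambda>(x, y). p x y) (snd q, fst q))"
    by (rule continuous_on_compose2[OF assms]) (auto intro!: continuous_intros)
  then show ?thesis
    by (simp add: case_prod_unfold)
qed

section \<open>Energy identity for waves without mixed derivatives\<close>

text \<open>The function \<open>exp (- t) E(t) - B t\<close> is nonincreasing.\<close>

lemma Gronwall_constant_source:
  fixes E :: "real \<Rightarrow> real"
  assumes der: "\<And>t. t \<in> {0..T} \<Longrightarrow> (E has_real_derivative E' t) (at t within {0..T})"
    and ineq: "\<And>t. t \<in> {0..T} \<Longrightarrow> E' t \<le> E t + B"
    and "E 0 = 0" and "0 \<le> B" and t: "t \<in> {0..T}"
  shows "E t \<le> exp T * T * B"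
proof -
  define \<phi> where "\<phi> s = exp (- s) * E s - B * s" for s
  have \<phi>_der: "(\<phi> has_real_derivative exp (- s) * (E' s - E s) - B) (at s within {0..T})"
    if "s \<in> {0..T}" for s
    unfolding \<phi>_def[abs_def] by (rule derivative_eq_intros der that refl | simp)+ (simp add: algebra_simps)
  have "\<phi> t \<le> \<phi> 0"
  proof (rule DERIV_nonpos_imp_decreasing_open[where f = \<phi> and a = 0 and b = t])
    show "0 \<le> t" using t by simp
    show "\<exists>y. (\<phi> has_real_derivative y) (at s) \<and> y \<le> 0" if "0 < s" "s < t" for s
    proof (intro exI conjI)
      show "(\<phi> has_real_derivative exp (- s) * (E' s - E s) - B) (at s)"
        using \<phi>_der[of s] that t at_within_Icc_at[of 0 s T] by simp
      have "exp (- s) * (E' s - E s) \<le> exp (- s) * B"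
        using ineq[of s] that t by (intro mult_left_mono) auto
      also have "\<dots> \<le> 1 * B"
        using that \<open>0 \<le> B\<close> by (intro mult_right_mono) auto
      finally show "exp (- s) * (E' s - E s) - B \<le> 0" by simp
    qed
    show "continuous_on {0..t} \<phi>"
      using DERIV_continuous_on[OF \<phi>_der] t by (auto intro: continuous_on_subset)
  qed
  then have "E t \<le> exp t * (B * t)"
    using \<open>E 0 = 0\<close> by (simp add: \<phi>_def exp_minus field_simps)
  also have "\<dots> \<le> exp T * (B * T)"
    using t \<open>0 \<le> B\<close> by (intro mult_mono mult_nonneg_nonneg) auto
  finally show ?thesis by (simp add: mult_ac)
qed

text \<open>A displacement with fixed ends and exactly the derivatives that occur in the wave equation and
  in its energy; no equation is imposed.\<close>

locale wave_field =
  fixes a b T :: real and z zt ztt zx zxx :: "real \<Rightarrow> real \<Rightarrow> real"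
  assumes ab: "a < b" and T_pos: "0 < T"
    and zt: "\<And>t x. t \<in> {0..T} \<Longrightarrow> x \<in> {a..b} \<Longrightarrow>
      ((\<lambda>s. z s x) has_real_derivative zt t x) (at t within {0..T})"
    and ztt: "\<And>t x. t \<in> {0..T} \<Longrightarrow> x \<in> {a..b} \<Longrightarrow>
      ((\<lambda>s. zt s x) has_real_derivative ztt t x) (at t within {0..T})"
    and zx: "\<And>t x. t \<in> {0..T} \<Longrightarrow> x \<in> {a..b} \<Longrightarrow>
      (z t has_real_derivative zx t x) (at x within {a..b})"
    and zxx: "\<And>t x. t \<in> {0..T} \<Longrightarrow> x \<in> {a..b} \<Longrightarrow>
      (zx t has_real_derivative zxx t x) (at x within {a..b})"
    and zt_cont: "continuous_on ({0..T} \<times> {a..b}) (\<lambda>(t, x). zt t x)"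
    and ztt_cont: "continuous_on ({0..T} \<times> {a..b}) (\<lambda>(t, x). ztt t x)"
    and zx_cont: "continuous_on ({0..T} \<times> {a..b}) (\<lambda>(t, x). zx t x)"
    and zxx_cont: "continuous_on ({0..T} \<times> {a..b}) (\<lambda>(t, x). zxx t x)"
    and fixed_ends: "\<And>t. t \<in> {0..T} \<Longrightarrow> z t a = 0" "\<And>t. t \<in> {0..T} \<Longrightarrow> z t b = 0"
begin

lemma z_continuous_on_space: "t \<in> {0..T} \<Longrightarrow> continuous_on {a..b} (z t)"
  by (rule DERIV_continuous_on[OF zx]) auto

lemma continuous_on_space:
  assumes "t \<in> {0..T}"
  shows "continuous_on {a..b} (zt t)" "continuous_on {a..b} (ztt t)"
    "continuous_on {a..b} (zx t)" "continuous_on {a..b} (zxx t)"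
  using assms by (auto intro: continuous_on_prod_slices(1)[where S = "{0..T}"]
      zt_cont ztt_cont zx_cont zxx_cont)

lemma kinetic_energy_has_derivative:
  assumes "t \<in> {0..T}"
  shows "((\<lambda>t. integral {a..b} (\<lambda>x. (zt t x)\<^sup>2)) has_real_derivative
    integral {a..b} (\<lambda>x. 2 * zt t x * ztt t x)) (at t within {0..T})"
  unfolding box_real[symmetric]
proof (rule leibniz_rule_field_derivative)
  show "((\<lambda>t. (zt t x)\<^sup>2) has_real_derivative 2 * zt s x * ztt s x) (at s within cbox 0 T)"
    if "s \<in> cbox 0 T" "x \<in> cbox a b" for s x
    using ztt[of s x] that by (auto intro!: derivative_eq_intros)
  show "(\<lambda>x. (zt s x)\<^sup>2) integrable_on cbox a b" if "s \<in> cbox 0 T" for s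
    using that continuous_on_space[of s]
    by (intro integrable_continuous continuous_intros) auto
  show "continuous_on (cbox 0 T \<times> cbox a b) (\<lambda>(s, x). 2 * zt s x * ztt s x)"
    using zt_cont ztt_cont by (auto simp: case_prod_unfold intro!: continuous_intros)
qed (use assms in auto)

text \<open>Integration by parts in space, applied to the factorised difference of squares
  \<open>z\<^sub>x(s)\<^sup>2 - z\<^sub>x(t)\<^sup>2 = (z\<^sub>x(s) - z\<^sub>x(t)) (z\<^sub>x(s) + z\<^sub>x(t))\<close>. The time increment then falls on \<open>z\<close>
  and not on \<open>z\<^sub>x\<close>, so that a limit of difference quotients in time exists without \<open>z\<^sub>x\<^sub>t\<close>.\<close>

lemma elastic_energy_increment:
  assumes s: "s \<in> {0..T}" and t: "t \<in> {0..T}"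
  shows "integral {a..b} (\<lambda>x. (zx s x)\<^sup>2) - integral {a..b} (\<lambda>x. (zx t x)\<^sup>2)
    = - integral {a..b} (\<lambda>x. (z s x - z t x) * (zxx s x + zxx t x))"
proof -
  have "((\<lambda>x. (zx s x - zx t x) * (zx s x + zx t x) + (z s x - z t x) * (zxx s x + zxx t x))
      has_integral (z s b - z t b) * (zx s b + zx t b) - (z s a - z t a) * (zx s a + zx t a)) {a..b}"
    by (rule fundamental_theorem_of_calculus)
      (use ab zx[OF s] zx[OF t] zxx[OF s] zxx[OF t] in
        \<open>auto simp flip: has_real_derivative_iff_has_vector_derivative intro!: derivative_eq_intros\<close>)
  then have "integral {a..b} (\<lambda>x. ((zx s x)\<^sup>2 - (zx t x)\<^sup>2) + (z s x - z t x) * (zxx s x + zxx t x)) = 0"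
    using fixed_ends s t by (simp add: integral_unique power2_eq_square algebra_simps)
  moreover have "(\<lambda>x. (zx s x)\<^sup>2) integrable_on {a..b}" "(\<lambda>x. (zx t x)\<^sup>2) integrable_on {a..b}"
    "(\<lambda>x. (z s x - z t x) * (zxx s x + zxx t x)) integrable_on {a..b}"
    using continuous_on_space[OF s] continuous_on_space[OF t]
      z_continuous_on_space[OF s] z_continuous_on_space[OF t]
    by (auto intro!: integrable_continuous_interval continuous_intros)
  ultimately show ?thesis
    by (simp add: integral_add integral_diff integrable_diff)
qed

text \<open>The second factor \<open>z\<^sub>x\<^sub>x(s) + z\<^sub>x\<^sub>x(t)\<close> of the increment need not be differentiable in \<open>s\<close>. It is
  split into the constant \<open>2 z\<^sub>x\<^sub>x(t)\<close>, which leaves an integral to be differentiated under the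
  integral sign, and the remainder \<open>z\<^sub>x\<^sub>x(s) - z\<^sub>x\<^sub>x(t)\<close>, which tends to zero and multiplies a term of
  order \<open>s - t\<close>.\<close>

lemma elastic_energy_has_derivative:
  assumes t: "t \<in> {0..T}"
  shows "((\<lambda>t. integral {a..b} (\<lambda>x. (zx t x)\<^sup>2)) has_real_derivative
    - integral {a..b} (\<lambda>x. 2 * zt t x * zxx t x)) (at t within {0..T})"
proof -
  define A where "A s = integral {a..b} (\<lambda>x. (z s x - z t x) * (2 * zxx t x))" for s
  define R where "R s = integral {a..b} (\<lambda>x. (z s x - z t x) * (zxx s x - zxx t x))" for s
  have zxx_t_cont: "continuous_on ({0..T} \<times> {a..b}) (\<lambda>(s, x). zxx t x)"
  proof -
    have "continuous_on ({0..T} \<times> {a..b}) (\<lambda>q. zxx t (snd q))"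
      by (rule continuous_on_compose2[OF continuous_on_space(4)[OF t]])
        (auto intro!: continuous_intros)
    then show ?thesis by (simp add: case_prod_unfold)
  qed
  have "(A has_real_derivative integral {a..b} (\<lambda>x. zt t x * (2 * zxx t x))) (at t within {0..T})"
    unfolding A_def[abs_def] box_real[symmetric]
  proof (rule leibniz_rule_field_derivative[where fx = "\<lambda>s x. zt s x * (2 * zxx t x)"])
    show "((\<lambda>s. (z s x - z t x) * (2 * zxx t x)) has_real_derivative zt s x * (2 * zxx t x))
        (at s within cbox 0 T)" if "s \<in> cbox 0 T" "x \<in> cbox a b" for s x
      using zt[of s x] that by (auto intro!: derivative_eq_intros)
    show "(\<lambda>x. (z s x - z t x) * (2 * zxx t x)) integrable_on cbox a b" if "s \<in> cbox 0 T" for s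
      using that continuous_on_space(4)[OF t] z_continuous_on_space[of s] z_continuous_on_space[OF t]
      by (intro integrable_continuous continuous_intros) auto
    show "continuous_on (cbox 0 T \<times> cbox a b) (\<lambda>(s, x). zt s x * (2 * zxx t x))"
      using zt_cont zxx_t_cont by (auto simp: case_prod_unfold intro!: continuous_intros)
  qed (use t in auto)
  moreover have "(R has_real_derivative 0) (at t within {0..T})"
  proof -
    have "compact ((\<lambda>(t, x). zt t x) ` ({0..T} \<times> {a..b}))"
      by (intro compact_continuous_image zt_cont compact_Times) auto
    then obtain K where K: "\<And>s x. s \<in> {0..T} \<Longrightarrow> x \<in> {a..b} \<Longrightarrow> \<bar>zt s x\<bar> \<le> K"
      by (fastforce dest!: compact_imp_bounded simp: bounded_iff)
    define \<omega> where "\<omega> s = integral {a..b} (\<lambda>x. \<bar>zxx s x - zxx t x\<bar>)" for s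
    have "continuous_on {0..T} \<omega>"
      unfolding \<omega>_def[abs_def] box_real[symmetric]
      by (rule integral_continuous_on_param)
        (use zxx_cont zxx_t_cont in \<open>auto simp: case_prod_unfold intro!: continuous_intros\<close>)
    then have "(\<omega> \<longlongrightarrow> \<omega> t) (at t within {0..T})"
      using t by (auto simp: continuous_on_def)
    moreover have "\<omega> t = 0"
      by (simp add: \<omega>_def)
    ultimately have \<omega>_lim: "((\<lambda>s. K * \<omega> s) \<longlongrightarrow> 0) (at t within {0..T})"
      by (intro tendsto_mult_right_zero) simp
    have quotient: "\<bar>(R s - R t) / (s - t)\<bar> \<le> K * \<omega> s" if s: "s \<in> {0..T}" "s \<noteq> t" for s
    proof -
      have "norm (R s) \<le> integral {a..b} (\<lambda>x. K * \<bar>s - t\<bar> * \<bar>zxx s x - zxx t x\<bar>)"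
        unfolding R_def
      proof (rule integral_norm_bound_integral)
        show "(\<lambda>x. (z s x - z t x) * (zxx s x - zxx t x)) integrable_on {a..b}"
          "(\<lambda>x. K * \<bar>s - t\<bar> * \<bar>zxx s x - zxx t x\<bar>) integrable_on {a..b}"
          using continuous_on_space[OF s(1)] continuous_on_space[OF t]
            z_continuous_on_space[OF s(1)] z_continuous_on_space[OF t]
          by (auto intro!: integrable_continuous_interval continuous_intros)
        show "norm ((z s x - z t x) * (zxx s x - zxx t x)) \<le> K * \<bar>s - t\<bar> * \<bar>zxx s x - zxx t x\<bar>"
          if x: "x \<in> {a..b}" for x
        proof -
          have "\<bar>z s x - z t x\<bar> \<le> K * \<bar>s - t\<bar>"
            by (rule real_derivative_bound_imp_Lipschitz[of "{0..T}" "\<lambda>s. z s x" "\<lambda>s. zt s x"])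
              (use zt K x s t in auto)
          then show ?thesis
            by (simp add: abs_mult mult_right_mono)
        qed
      qed
      also have "\<dots> = K * \<omega> s * \<bar>s - t\<bar>"
        by (simp add: \<omega>_def mult_ac)
      finally show ?thesis
        using s by (simp add: R_def[of t] divide_le_eq)
    qed
    have "((\<lambda>s. (R s - R t) / (s - t)) \<longlongrightarrow> 0) (at t within {0..T})"
    proof (rule Lim_null_comparison[OF _ \<omega>_lim])
      show "\<forall>\<^sub>F s in at t within {0..T}. norm ((R s - R t) / (s - t)) \<le> K * \<omega> s"
        unfolding eventually_at_filter real_norm_def
        by (rule always_eventually) (use quotient in blast)
    qed
    then show ?thesis
      by (simp add: has_field_derivative_iff)
  qed
  ultimately have "((\<lambda>s. integral {a..b} (\<lambda>x. (zx t x)\<^sup>2) - (A s + R s)) has_real_derivative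
      0 - (integral {a..b} (\<lambda>x. zt t x * (2 * zxx t x)) + 0)) (at t within {0..T})"
    by (intro derivative_intros)
  then have "((\<lambda>s. integral {a..b} (\<lambda>x. (zx s x)\<^sup>2)) has_real_derivative
      0 - (integral {a..b} (\<lambda>x. zt t x * (2 * zxx t x)) + 0)) (at t within {0..T})"
  proof (rule has_field_derivative_transform_within[OF _ zero_less_one t])
    fix s assume s: "s \<in> {0..T}"
    have "(\<lambda>x. (z s x - z t x) * (2 * zxx t x)) integrable_on {a..b}"
      "(\<lambda>x. (z s x - z t x) * (zxx s x - zxx t x)) integrable_on {a..b}"
      using continuous_on_space[OF s] continuous_on_space[OF t]
        z_continuous_on_space[OF s] z_continuous_on_space[OF t]
      by (auto intro!: integrable_continuous_interval continuous_intros)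
    then have "A s + R s = integral {a..b}
        (\<lambda>x. (z s x - z t x) * (2 * zxx t x) + (z s x - z t x) * (zxx s x - zxx t x))"
      unfolding A_def R_def by (simp add: integral_add)
    also have "\<dots> = integral {a..b} (\<lambda>x. (z s x - z t x) * (zxx s x + zxx t x))"
      by (rule arg_cong[where f = "integral {a..b}"]) (simp add: algebra_simps)
    finally show "integral {a..b} (\<lambda>x. (zx t x)\<^sup>2) - (A s + R s) = integral {a..b} (\<lambda>x. (zx s x)\<^sup>2)"
      using elastic_energy_increment[OF s t] by simp
  qed
  then show ?thesis
    by (simp add: mult_ac)
qed

text \<open>The rate of change of the energy is \<open>2 \<integral> z\<^sub>t d\<close> with \<open>d = \<rho> z\<^sub>t\<^sub>t - Y z\<^sub>x\<^sub>x\<close>, and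
  \<open>2 z\<^sub>t d \<le> \<rho> z\<^sub>t\<^sup>2 + d\<^sup>2 / \<rho>\<close> absorbs the velocity into the energy.\<close>

lemma energy_estimate:
  assumes \<rho>: "0 < \<rho>" and Y: "0 < Y"
    and init: "\<And>x. x \<in> {a..b} \<Longrightarrow> z 0 x = 0" "\<And>x. x \<in> {a..b} \<Longrightarrow> zt 0 x = 0"
    and residual: "\<And>t x. t \<in> {0..T} \<Longrightarrow> x \<in> {a..b} \<Longrightarrow> \<bar>\<rho> * ztt t x - Y * zxx t x\<bar> \<le> r"
    and t: "t \<in> {0..T}"
  shows "integral {a..b} (\<lambda>x. \<rho> * (zt t x)\<^sup>2) + integral {a..b} (\<lambda>x. Y * (zx t x)\<^sup>2)
    \<le> exp T * T * ((b - a) * r\<^sup>2 / \<rho>)"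
proof -
  define E where "E t = \<rho> * integral {a..b} (\<lambda>x. (zt t x)\<^sup>2) + Y * integral {a..b} (\<lambda>x. (zx t x)\<^sup>2)" for t
  define E' where "E' t = \<rho> * integral {a..b} (\<lambda>x. 2 * zt t x * ztt t x)
    + Y * (- integral {a..b} (\<lambda>x. 2 * zt t x * zxx t x))" for t
  have "E t \<le> exp T * T * ((b - a) * r\<^sup>2 / \<rho>)"
  proof (rule Gronwall_constant_source[where E = E and E' = E'])
    fix t assume t: "t \<in> {0..T}"
    show "(E has_real_derivative E' t) (at t within {0..T})"
      unfolding E_def[abs_def] E'_def
      by (intro DERIV_add DERIV_cmult kinetic_energy_has_derivative elastic_energy_has_derivative t)
    have int: "(\<lambda>x. 2 * zt t x * ztt t x) integrable_on {a..b}"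
      "(\<lambda>x. 2 * zt t x * zxx t x) integrable_on {a..b}"
      "(\<lambda>x. (zt t x)\<^sup>2) integrable_on {a..b}" "(\<lambda>x. (zx t x)\<^sup>2) integrable_on {a..b}"
      "(\<lambda>x. 2 * zt t x * (\<rho> * ztt t x - Y * zxx t x)) integrable_on {a..b}"
      "(\<lambda>x. \<rho> * (zt t x)\<^sup>2 + r\<^sup>2 / \<rho>) integrable_on {a..b}"
      using continuous_on_space[OF t]
      by (auto intro!: integrable_continuous_interval continuous_intros)
    have "E' t = integral {a..b} (\<lambda>x. \<rho> * (2 * zt t x * ztt t x)) - integral {a..b} (\<lambda>x. Y * (2 * zt t x * zxx t x))"
      by (simp add: E'_def)
    also have "\<dots> = integral {a..b} (\<lambda>x. \<rho> * (2 * zt t x * ztt t x) - Y * (2 * zt t x * zxx t x))"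
      by (rule integral_diff[symmetric])
        (use int(1,2) in \<open>auto intro: integrable_on_mult_right\<close>)
    also have "\<dots> = integral {a..b} (\<lambda>x. 2 * zt t x * (\<rho> * ztt t x - Y * zxx t x))"
      by (rule arg_cong[where f = "integral {a..b}"]) (simp add: algebra_simps)
    also have "\<dots> \<le> integral {a..b} (\<lambda>x. \<rho> * (zt t x)\<^sup>2 + r\<^sup>2 / \<rho>)"
    proof (rule integral_le[OF int(5,6)])
      fix x assume x: "x \<in> {a..b}"
      define d where "d = \<rho> * ztt t x - Y * zxx t x"
      have "0 \<le> (\<rho> * zt t x - d)\<^sup>2 / \<rho>"
        using \<rho> by simp
      then have "2 * zt t x * d \<le> \<rho> * (zt t x)\<^sup>2 + d\<^sup>2 / \<rho>"
        using \<rho> by (simp add: power2_eq_square field_simps)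
      moreover have "d\<^sup>2 \<le> r\<^sup>2"
        using residual[OF t x] by (simp add: d_def abs_le_square_iff[symmetric])
      then have "d\<^sup>2 / \<rho> \<le> r\<^sup>2 / \<rho>"
        using \<rho> by (simp add: divide_right_mono)
      ultimately show "2 * zt t x * (\<rho> * ztt t x - Y * zxx t x) \<le> \<rho> * (zt t x)\<^sup>2 + r\<^sup>2 / \<rho>"
        by (simp add: d_def)
    qed
    also have "\<dots> = integral {a..b} (\<lambda>x. \<rho> * (zt t x)\<^sup>2) + integral {a..b} (\<lambda>_. r\<^sup>2 / \<rho>)"
      by (intro Henstock_Kurzweil_Integration.integral_add integrable_on_mult_right int(3)
          integrable_const_ivl)
    also have "\<dots> = \<rho> * integral {a..b} (\<lambda>x. (zt t x)\<^sup>2) + (b - a) * r\<^sup>2 / \<rho>"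
      using ab by simp
    also have "\<dots> \<le> E t + (b - a) * r\<^sup>2 / \<rho>"
      using Y integral_nonneg[OF int(4)] by (simp add: E_def)
    finally show "E' t \<le> E t + (b - a) * r\<^sup>2 / \<rho>" .
  next
    have "zx 0 x = 0" if x: "x \<in> {a..b}" for x
    proof -
      have "((\<lambda>_. 0) has_real_derivative zx 0 x) (at x within {a..b})"
        using zx[of 0 x] x T_pos init(1)
        by (auto intro: has_field_derivative_transform_within[OF _ zero_less_one x])
      then show ?thesis
        using deriv_on_eqI[OF ab x] DERIV_const by metis
    qed
    then have "integral {a..b} (\<lambda>x. (zx 0 x)\<^sup>2) = integral {a..b} (\<lambda>_. 0)"
      by (intro Henstock_Kurzweil_Integration.integral_cong) simp
    moreover have "integral {a..b} (\<lambda>x. (zt 0 x)\<^sup>2) = integral {a..b} (\<lambda>_. 0)"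
      using init(2) by (intro Henstock_Kurzweil_Integration.integral_cong) simp
    ultimately show "E 0 = 0"
      by (simp add: E_def)
    show "0 \<le> (b - a) * r\<^sup>2 / \<rho>"
      using ab \<rho> by simp
  qed (use t in auto)
  then show ?thesis
    by (simp add: E_def)
qed

end

text \<open>The pointwise inequality behind this form of Poincare's inequality is
  \<open>((x - a) v\<^sup>2)' \<ge> v\<^sup>2 / 2 - 2 (b - a)\<^sup>2 v'\<^sup>2\<close>; the left side integrates to zero
  because \<open>(x - a) v\<^sup>2\<close> vanishes at both ends.\<close>

lemma Poincare_inequality:
  fixes v v' :: "real \<Rightarrow> real"
  assumes "a \<le> b" and "v b = 0"
    and der: "\<And>x. x \<in> {a..b} \<Longrightarrow> (v has_real_derivative v' x) (at x within {a..b})"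
    and cont: "continuous_on {a..b} v'"
  shows "integral {a..b} (\<lambda>x. (v x)\<^sup>2) \<le> 4 * (b - a)\<^sup>2 * integral {a..b} (\<lambda>x. (v' x)\<^sup>2)"
proof -
  have v_cont: "continuous_on {a..b} v"
    using der by (rule DERIV_continuous_on)
  have int: "(\<lambda>x. (v x)\<^sup>2) integrable_on {a..b}" "(\<lambda>x. (v' x)\<^sup>2) integrable_on {a..b}"
    using v_cont cont by (auto intro!: integrable_continuous_interval continuous_intros)
  have "((\<lambda>x. (v x)\<^sup>2 + (x - a) * (2 * v x * v' x)) has_integral (b - a) * (v b)\<^sup>2 - (a - a) * (v a)\<^sup>2) {a..b}"
    by (rule fundamental_theorem_of_calculus)
      (use assms in \<open>auto simp flip: has_real_derivative_iff_has_vector_derivative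
        intro!: derivative_eq_intros\<close>)
  then have zero: "((\<lambda>x. (v x)\<^sup>2 + (x - a) * (2 * v x * v' x)) has_integral 0) {a..b}"
    using \<open>v b = 0\<close> by simp
  have "integral {a..b} (\<lambda>x. (v x)\<^sup>2 / 2 - 2 * (b - a)\<^sup>2 * (v' x)\<^sup>2)
      \<le> integral {a..b} (\<lambda>x. (v x)\<^sup>2 + (x - a) * (2 * v x * v' x))"
  proof (rule integral_le)
    show "(\<lambda>x. (v x)\<^sup>2 / 2 - 2 * (b - a)\<^sup>2 * (v' x)\<^sup>2) integrable_on {a..b}"
      using v_cont cont by (auto intro!: integrable_continuous_interval continuous_intros)
    show "(\<lambda>x. (v x)\<^sup>2 + (x - a) * (2 * v x * v' x)) integrable_on {a..b}"
      using zero by blast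
    fix x assume x: "x \<in> {a..b}"
    have "0 \<le> (v x + 2 * ((x - a) * v' x))\<^sup>2"
      by simp
    then have "(v x)\<^sup>2 / 2 - 2 * ((x - a)\<^sup>2 * (v' x)\<^sup>2) \<le> (v x)\<^sup>2 + (x - a) * (2 * v x * v' x)"
      by (simp add: power2_eq_square algebra_simps)
    moreover have "(x - a)\<^sup>2 * (v' x)\<^sup>2 \<le> (b - a)\<^sup>2 * (v' x)\<^sup>2"
      using x by (intro mult_right_mono power_mono) auto
    ultimately show "(v x)\<^sup>2 / 2 - 2 * (b - a)\<^sup>2 * (v' x)\<^sup>2 \<le> (v x)\<^sup>2 + (x - a) * (2 * v x * v' x)"
      by simp
  qed
  also have "\<dots> = 0"
    using zero by (rule integral_unique)
  also have "integral {a..b} (\<lambda>x. (v x)\<^sup>2 / 2 - 2 * (b - a)\<^sup>2 * (v' x)\<^sup>2)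
      = integral {a..b} (\<lambda>x. (v x)\<^sup>2) / 2 - 2 * (b - a)\<^sup>2 * integral {a..b} (\<lambda>x. (v' x)\<^sup>2)"
    using int by (simp add: integral_diff integrable_on_divide integrable_on_mult_right)
  finally show ?thesis by simp
qed

section \<open>The error is a wave with a residual of second order\<close>

locale peridynamic_error = peridynamic_material f J M
  for f J :: "real \<Rightarrow> real" and M :: real +
  fixes a b T \<rho> C1 \<epsilon> :: real and body u w :: "real \<Rightarrow> real \<Rightarrow> real" and g h :: "real \<Rightarrow> real"
  assumes ab: "a < b" and T_pos: "0 < T" and \<rho>_pos: "0 < \<rho>" and eps: "0 < \<epsilon>"
    and u_sol: "elastodynamic_solution a b T \<rho> Y body g h u"
    and w_sol: "peridynamic_solution a b T \<rho> f J body g h \<epsilon> w"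
    and w_C4: "\<And>t. t \<in> {0..T} \<Longrightarrow> C_k_on 4 {a..b} (w t)"
    and w_fourth: "\<And>t x. t \<in> {0..T} \<Longrightarrow> x \<in> {a..b} \<Longrightarrow> \<bar>(deriv_on {a..b} ^^ 4) (w t) x\<bar> \<le> C1"
begin

abbreviation dt :: "nat \<Rightarrow> (real \<Rightarrow> real \<Rightarrow> real) \<Rightarrow> real \<Rightarrow> real \<Rightarrow> real" where
  "dt k p t x \<equiv> (deriv_on {0..T} ^^ k) (\<lambda>s. p s x) t"

abbreviation dx :: "nat \<Rightarrow> (real \<Rightarrow> real \<Rightarrow> real) \<Rightarrow> real \<Rightarrow> real \<Rightarrow> real" where
  "dx k p t x \<equiv> (deriv_on {a..b} ^^ k) (p t) x"

abbreviation force :: "real \<Rightarrow> real \<Rightarrow> real" where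
  "force t x \<equiv> peridynamic_force f J \<epsilon> (w t) x"

lemma u_time: "x \<in> {a..b} \<Longrightarrow> C_k_on 2 {0..T} (\<lambda>s. u s x)"
  and u_space: "t \<in> {0..T} \<Longrightarrow> C_k_on 2 {a..b} (u t)"
  and u_dt_cont: "k \<le> 2 \<Longrightarrow> continuous_on ({0..T} \<times> {a..b}) (\<lambda>(t, x). dt k u t x)"
  and u_dx_cont: "k \<le> 2 \<Longrightarrow> continuous_on ({0..T} \<times> {a..b}) (\<lambda>(t, x). dx k u t x)"
  and u_eq: "t \<in> {0..T} \<Longrightarrow> x \<in> {a..b} \<Longrightarrow> \<rho> * dt 2 u t x = Y * dx 2 u t x + body t x"
  and u_ends: "t \<in> {0..T} \<Longrightarrow> u t a = 0" "t \<in> {0..T} \<Longrightarrow> u t b = 0"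
  and u_init: "x \<in> {a..b} \<Longrightarrow> u 0 x = g x" "x \<in> {a..b} \<Longrightarrow> deriv_on {0..T} (\<lambda>s. u s x) 0 = h x"
  using u_sol unfolding elastodynamic_solution_def initial_data_def by blast+

lemma w_time: "x \<in> {a..b} \<Longrightarrow> C_k_on 2 {0..T} (\<lambda>s. w s x)"
  and w_eq: "t \<in> {0..T} \<Longrightarrow> x \<in> {a..b} \<Longrightarrow> \<rho> * dt 2 w t x = force t x + body t x"
  and w_layer: "t \<in> {0..T} \<Longrightarrow> x \<in> nonlocal_boundary a b \<epsilon> \<Longrightarrow> w t x = 0"
  and w_init: "x \<in> {a..b} \<Longrightarrow> w 0 x = g x" "x \<in> {a..b} \<Longrightarrow> deriv_on {0..T} (\<lambda>s. w s x) 0 = h x"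
  using w_sol unfolding peridynamic_solution_def initial_data_def by blast+

lemma w_displacement: "t \<in> {0..T} \<Longrightarrow> layer_displacement a b \<epsilon> C1 (w t)"
  using ab eps w_C4 w_layer w_fourth by unfold_locales auto

text \<open>Bonds shorter than \<open>\<epsilon>\<close> that start in \<open>[a,b]\<close> and leave it end in the layer. This is why the
  force only sees the extension by zero, whatever \<open>w\<close> is farther out.\<close>

lemma w_eq_extension:
  assumes t: "t \<in> {0..T}" and x: "x \<in> {a..b}" and y: "y \<in> {x - \<epsilon><..<x + \<epsilon>}"
  shows "w t y = layer_displacement.V a b (w t) 0 y"
proof (cases "y \<in> {a..b}")
  case True
  then show ?thesis
    using layer_displacement.V_inside[OF w_displacement[OF t], of y 0] by simp
next
  case False
  then have "y \<in> nonlocal_boundary a b \<epsilon>"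
    using x y by (auto simp: nonlocal_boundary_def)
  then show ?thesis
    using w_layer[OF t] layer_displacement.V_outside[OF w_displacement[OF t] False] by simp
qed

lemma force_consistency:
  assumes t: "t \<in> {0..T}" and x: "x \<in> {a..b}"
  shows "\<bar>force t x - Y * dx 2 w t x\<bar> \<le> Y * (C1 / 12) * \<epsilon>\<^sup>2"
proof -
  interpret layer_displacement a b \<epsilon> C1 "w t"
    using t by (rule w_displacement)
  have "\<bar>force t x - Y * V 2 x\<bar> \<le> Y * (C1 / 12) * \<epsilon>\<^sup>2"
    by (rule peridynamic_force_consistency[OF eps])
      (use V_has_real_derivative V_bound[of 4] V_Lipschitz[of 0] w_eq_extension[OF t x] in auto)
  then show ?thesis
    using V_inside[OF x] by simp
qed

lemma force_Lipschitz:
  assumes t: "t \<in> {0..T}" and x: "x \<in> {a..b}" and y: "y \<in> {a..b}"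
  shows "\<bar>force t x - force t y\<bar> \<le> Y * (C1 * (b - a)) * \<bar>x - y\<bar>"
proof -
  interpret layer_displacement a b \<epsilon> C1 "w t"
    using t by (rule w_displacement)
  show ?thesis
    by (rule peridynamic_force_Lipschitz[OF eps, where W = V])
      (use V_has_real_derivative V_bound[of 3] V_bound[of 2] V_Lipschitz[of 0]
        w_eq_extension[OF t x] w_eq_extension[OF t y] in auto)
qed

lemma w_dx_Lipschitz:
  assumes "t \<in> {0..T}" and "x \<in> {a..b}" and "y \<in> {a..b}" and "j < 4"
  shows "\<bar>dx j w t x - dx j w t y\<bar> \<le> C1 * (b - a) ^ (3 - j) * \<bar>x - y\<bar>"
proof -
  interpret layer_displacement a b \<epsilon> C1 "w t"
    using assms(1) by (rule w_displacement)
  show ?thesis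
    using V_Lipschitz[OF assms(4), of x y] V_inside assms(2,3) by simp
qed

text \<open>Continuity in time is inherited by each space derivative from the previous one, starting from
  the displacement itself.\<close>

lemma w_dx_cont:
  assumes "k < 4"
  shows "continuous_on ({0..T} \<times> {a..b}) (\<lambda>(t, x). dx k w t x)"
  using assms
proof (induction k)
  case 0
  show ?case
  proof (rule continuous_on_prod_if_uniformly_Lipschitz)
    show "continuous_on {0..T} (\<lambda>t. dx 0 w t x)" if "x \<in> {a..b}" for x
      using C_k_on_imp_continuous_on_iterate[OF w_time[OF that], of 0] by simp
  qed (rule w_dx_Lipschitz; simp)
next
  case (Suc k)
  show ?case
  proof (rule derivative_continuous_on_prod_if_uniformly_Lipschitz[OF ab])
    show "continuous_on {0..T} (\<lambda>t. dx k w t x)" if "x \<in> {a..b}" for x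
      using continuous_on_prod_slices(2)[OF Suc.IH that] Suc.prems by simp
    show "(dx k w t has_real_derivative dx (Suc k) w t x) (at x within {a..b})"
      if "t \<in> {0..T}" "x \<in> {a..b}" for t x
      using C_k_on_has_real_derivative[OF w_C4[OF that(1)] _ that(2), of k] Suc.prems by simp
    show "\<bar>dx (Suc k) w t x - dx (Suc k) w t y\<bar> \<le> C1 * (b - a) ^ (3 - Suc k) * \<bar>x - y\<bar>"
      if "t \<in> {0..T}" "x \<in> {a..b}" "y \<in> {a..b}" for t x y
      using that Suc.prems by (rule w_dx_Lipschitz)
  qed
qed

text \<open>Solvability of the local equation by a classical solution forces the load to be continuous.\<close>

lemma body_cont: "continuous_on ({0..T} \<times> {a..b}) (\<lambda>(t, x). body t x)"
proof (rule continuous_on_eq)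
  show "continuous_on ({0..T} \<times> {a..b}) (\<lambda>q. \<rho> * dt 2 u (fst q) (snd q) - Y * dx 2 u (fst q) (snd q))"
    using u_dt_cont[of 2] u_dx_cont[of 2] by (auto simp: case_prod_unfold intro!: continuous_intros)
  show "\<rho> * dt 2 u (fst q) (snd q) - Y * dx 2 u (fst q) (snd q) = (case q of (t, x) \<Rightarrow> body t x)"
    if "q \<in> {0..T} \<times> {a..b}" for q
    using u_eq[of "fst q" "snd q"] that by (auto simp: case_prod_unfold)
qed

text \<open>Continuity in time at a fixed point is read off the nonlocal equation, in which all other terms
  are continuous in time.\<close>

lemma force_cont: "continuous_on ({0..T} \<times> {a..b}) (\<lambda>(t, x). force t x)"
proof (rule continuous_on_prod_if_uniformly_Lipschitz[OF _ force_Lipschitz])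
  fix x assume x: "x \<in> {a..b}"
  show "continuous_on {0..T} (\<lambda>t. force t x)"
  proof (rule continuous_on_eq)
    show "continuous_on {0..T} (\<lambda>t. \<rho> * dt 2 w t x - body t x)"
      using C_k_on_imp_continuous_on_iterate[OF w_time[OF x], of 2]
        continuous_on_prod_slices(2)[OF body_cont x]
      by (intro continuous_intros) auto
    show "\<rho> * dt 2 w t x - body t x = force t x" if "t \<in> {0..T}" for t
      using w_eq[OF that x] by simp
  qed
qed

lemma w_dtt_cont: "continuous_on ({0..T} \<times> {a..b}) (\<lambda>(t, x). dt 2 w t x)"
proof (rule continuous_on_eq)
  show "continuous_on ({0..T} \<times> {a..b}) (\<lambda>q. (force (fst q) (snd q) + body (fst q) (snd q)) / \<rho>)"
    using force_cont body_cont \<rho>_pos by (auto simp: case_prod_unfold intro!: continuous_intros)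
  show "(force (fst q) (snd q) + body (fst q) (snd q)) / \<rho> = (case q of (t, x) \<Rightarrow> dt 2 w t x)"
    if "q \<in> {0..T} \<times> {a..b}" for q
    using w_eq[of "fst q" "snd q"] that \<rho>_pos by (auto simp: case_prod_unfold field_simps)
qed

lemma w_dt_has_derivative:
  assumes "x \<in> {a..b}" and "t \<in> {0..T}" and "k < 2"
  shows "((\<lambda>s. dt k w s x) has_real_derivative dt (Suc k) w t x) (at t within {0..T})"
  using C_k_on_has_real_derivative[OF w_time] assms by simp

text \<open>The argument for the space derivatives with time and space exchanged: a bound on the
  acceleration makes the velocity Lipschitz in time uniformly in space.\<close>

lemma w_dt_cont: "continuous_on ({0..T} \<times> {a..b}) (\<lambda>(t, x). dt 1 w t x)"
proof -
  have "compact ((\<lambda>(t, x). dt 2 w t x) ` ({0..T} \<times> {a..b}))"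
    by (intro compact_continuous_image w_dtt_cont compact_Times) auto
  then obtain K where K: "\<And>t x. t \<in> {0..T} \<Longrightarrow> x \<in> {a..b} \<Longrightarrow> \<bar>dt 2 w t x\<bar> \<le> K"
    by (fastforce dest!: compact_imp_bounded simp: bounded_iff)
  have "continuous_on ({a..b} \<times> {0..T}) (\<lambda>(x, t). dt 1 w t x)"
  proof (rule derivative_continuous_on_prod_if_uniformly_Lipschitz[OF T_pos])
    show "continuous_on {a..b} (\<lambda>x. w t x)" if "t \<in> {0..T}" for t
      using C_k_on_imp_continuous_on_iterate[OF w_C4[OF that], of 0] by simp
    show "((\<lambda>s. w s x) has_real_derivative dt 1 w t x) (at t within {0..T})"
      if "x \<in> {a..b}" "t \<in> {0..T}" for x t
      using w_dt_has_derivative[OF that, of 0] by simp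
    show "\<bar>dt 1 w t x - dt 1 w s x\<bar> \<le> K * \<bar>t - s\<bar>"
      if "x \<in> {a..b}" "t \<in> {0..T}" "s \<in> {0..T}" for x t s
    proof (rule real_derivative_bound_imp_Lipschitz[OF _ _ _ that(2,3)])
      show "((\<lambda>s. dt 1 w s x) has_real_derivative dt 2 w r x) (at r within {0..T})" if "r \<in> {0..T}" for r
        using w_dt_has_derivative[OF \<open>x \<in> {a..b}\<close> that, of 1] by (simp add: numeral_2_eq_2)
    qed (use K that in auto)
  qed
  then show ?thesis
    by (rule continuous_on_prod_swap)
qed

sublocale err: wave_field a b T "\<lambda>t x. w t x - u t x"
  "\<lambda>t x. dt 1 w t x - dt 1 u t x" "\<lambda>t x. dt 2 w t x - dt 2 u t x"
  "\<lambda>t x. dx 1 w t x - dx 1 u t x" "\<lambda>t x. dx 2 w t x - dx 2 u t x"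
proof
  fix t x assume t: "t \<in> {0..T}" and x: "x \<in> {a..b}"
  have time: "((\<lambda>s. dt k u s x) has_real_derivative dt (Suc k) u t x) (at t within {0..T})"
    if "k < 2" for k
    using C_k_on_has_real_derivative[OF u_time[OF x] that t] by simp
  have space: "(dx k p t has_real_derivative dx (Suc k) p t x) (at x within {a..b})"
    if "k < 2" "p \<in> {u, w}" for k p
    using C_k_on_has_real_derivative[OF u_space[OF t] _ x, of k]
      C_k_on_has_real_derivative[OF w_C4[OF t] _ x, of k] that by auto
  show "((\<lambda>s. w s x - u s x) has_real_derivative dt 1 w t x - dt 1 u t x) (at t within {0..T})"
    using DERIV_diff[OF w_dt_has_derivative[OF x t, of 0] time[of 0]] by simp
  show "((\<lambda>s. dt 1 w s x - dt 1 u s x) has_real_derivative dt 2 w t x - dt 2 u t x) (at t within {0..T})"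
    using DERIV_diff[OF w_dt_has_derivative[OF x t, of 1] time[of 1]] by (simp add: numeral_2_eq_2)
  show "((\<lambda>y. w t y - u t y) has_real_derivative dx 1 w t x - dx 1 u t x) (at x within {a..b})"
    using DERIV_diff[OF space[of 0 w] space[of 0 u]] by simp
  show "((\<lambda>y. dx 1 w t y - dx 1 u t y) has_real_derivative dx 2 w t x - dx 2 u t x) (at x within {a..b})"
    using DERIV_diff[OF space[of 1 w] space[of 1 u]] by (simp add: numeral_2_eq_2)
next
  fix t assume t: "t \<in> {0..T}"
  have "{a, b} \<subseteq> nonlocal_boundary a b \<epsilon>"
    using eps by (auto simp: nonlocal_boundary_def)
  then show "w t a - u t a = 0" "w t b - u t b = 0"
    using w_layer[OF t] u_ends[OF t] by auto
qed (use ab T_pos w_dt_cont w_dtt_cont w_dx_cont[of 1] w_dx_cont[of 2] u_dt_cont[of 1] u_dt_cont[of 2]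
    u_dx_cont[of 1] u_dx_cont[of 2] in \<open>auto simp: case_prod_unfold intro!: continuous_intros\<close>)

lemma error_dx:
  assumes "t \<in> {0..T}" and "x \<in> {a..b}"
  shows "deriv_on {a..b} (\<lambda>x. w t x - u t x) x = dx 1 w t x - dx 1 u t x"
  using deriv_on_eqI[OF ab assms(2) err.zx[OF assms]] .

lemma error_dt:
  assumes "t \<in> {0..T}" and "x \<in> {a..b}"
  shows "deriv_on {0..T} (\<lambda>s. w s x - u s x) t = dt 1 w t x - dt 1 u t x"
  using deriv_on_eqI[OF T_pos assms(1) err.zt[OF assms]] .

lemma error_energy_eq:
  assumes "t \<in> {0..T}"
  shows "error_energy a b T \<rho> Y (\<lambda>t x. w t x - u t x) t =
    integral {a..b} (\<lambda>x. \<rho> * (dt 1 w t x - dt 1 u t x)\<^sup>2) +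
    integral {a..b} (\<lambda>x. Y * (dx 1 w t x - dx 1 u t x)\<^sup>2)"
proof -
  have "integral {a..b} (\<lambda>x. \<rho> * \<bar>deriv_on {0..T} (\<lambda>s. w s x - u s x) t\<bar>\<^sup>2)
      = integral {a..b} (\<lambda>x. \<rho> * (dt 1 w t x - dt 1 u t x)\<^sup>2)"
    by (rule Henstock_Kurzweil_Integration.integral_cong) (simp only: error_dt[OF assms] power2_abs)
  moreover have "integral {a..b} (\<lambda>x. Y * \<bar>deriv_on {a..b} (\<lambda>x. w t x - u t x) x\<bar>\<^sup>2)
      = integral {a..b} (\<lambda>x. Y * (dx 1 w t x - dx 1 u t x)\<^sup>2)"
    by (rule Henstock_Kurzweil_Integration.integral_cong) (simp only: error_dx[OF assms] power2_abs)
  ultimately show ?thesis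
    by (simp only: error_energy_def)
qed

lemma error_energy_bound:
  assumes t: "t \<in> {0..T}"
  shows "error_energy a b T \<rho> Y (\<lambda>t x. w t x - u t x) t
    \<le> exp T * T * ((b - a) * (Y * (C1 / 12))\<^sup>2 / \<rho>) * \<epsilon> ^ 4"
proof -
  have bound: "integral {a..b} (\<lambda>x. \<rho> * (dt 1 w t x - dt 1 u t x)\<^sup>2) +
      integral {a..b} (\<lambda>x. Y * (dx 1 w t x - dx 1 u t x)\<^sup>2)
      \<le> exp T * T * ((b - a) * (Y * (C1 / 12) * \<epsilon>\<^sup>2)\<^sup>2 / \<rho>)"
  proof (rule err.energy_estimate[OF \<rho>_pos modulus_pos _ _ _ t])
    fix x assume x: "x \<in> {a..b}"
    show "w 0 x - u 0 x = 0" "dt 1 w 0 x - dt 1 u 0 x = 0"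
      using w_init[OF x] u_init[OF x] by auto
  next
    fix t x assume "t \<in> {0..T}" "x \<in> {a..b}"
    then show "\<bar>\<rho> * (dt 2 w t x - dt 2 u t x) - Y * (dx 2 w t x - dx 2 u t x)\<bar> \<le> Y * (C1 / 12) * \<epsilon>\<^sup>2"
      using w_eq u_eq force_consistency by (simp add: right_diff_distrib)
  qed
  have square: "(A * \<epsilon>\<^sup>2)\<^sup>2 = A\<^sup>2 * \<epsilon> ^ 4" for A
    by (simp add: power_mult_distrib flip: power_mult)
  show ?thesis
    using bound unfolding error_energy_eq[OF t] square
    by (simp only: mult.assoc times_divide_eq_left times_divide_eq_right)
qed

lemma error_H1_norm_le_energy:
  assumes t: "t \<in> {0..T}"
  shows "(H1_norm a b (\<lambda>x. w t x - u t x))\<^sup>2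
    \<le> (4 * (b - a)\<^sup>2 + 1) / Y * error_energy a b T \<rho> Y (\<lambda>t x. w t x - u t x) t"
proof -
  define P where "P = integral {a..b} (\<lambda>x. (w t x - u t x)\<^sup>2)"
  define S where "S = integral {a..b} (\<lambda>x. (dx 1 w t x - dx 1 u t x)\<^sup>2)"
  define K where "K = integral {a..b} (\<lambda>x. \<rho> * (dt 1 w t x - dt 1 u t x)\<^sup>2)"
  have cont: "continuous_on {a..b} (\<lambda>x. w t x - u t x)"
    "continuous_on {a..b} (\<lambda>x. dx 1 w t x - dx 1 u t x)"
    "continuous_on {a..b} (\<lambda>x. dt 1 w t x - dt 1 u t x)"
    using err.z_continuous_on_space[OF t] err.continuous_on_space[OF t] by auto
  have "0 \<le> P" and "0 \<le> S" and "0 \<le> K"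
    unfolding P_def S_def K_def
    by (rule integral_nonneg;
        use cont \<rho>_pos in \<open>auto intro!: integrable_continuous_interval continuous_intros\<close>)+
  note nonneg = this
  have "P \<le> 4 * (b - a)\<^sup>2 * S"
    unfolding P_def S_def using ab err.fixed_ends(2)[OF t] err.zx[OF t] cont(2)
    by (intro Poincare_inequality) auto
  have "integral {a..b} (\<lambda>x. \<bar>deriv_on {a..b} (\<lambda>x. w t x - u t x) x\<bar>\<^sup>2) = S"
    unfolding S_def
    by (rule Henstock_Kurzweil_Integration.integral_cong) (simp only: error_dx[OF t] power2_abs)
  then have "(H1_norm a b (\<lambda>x. w t x - u t x))\<^sup>2 = P + S"
    using nonneg by (simp add: H1_norm_def P_def)
  also have "\<dots> \<le> (4 * (b - a)\<^sup>2 + 1) * S"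
    using \<open>P \<le> _\<close> by (simp add: algebra_simps)
  also have "\<dots> \<le> (4 * (b - a)\<^sup>2 + 1) * ((K + Y * S) / Y)"
    using nonneg modulus_pos by (intro mult_left_mono) (auto simp: field_simps)
  also have "K + Y * S = error_energy a b T \<rho> Y (\<lambda>t x. w t x - u t x) t"
    by (simp add: error_energy_eq[OF t] K_def S_def)
  finally show ?thesis by simp
qed

end

theorem theorem2:
  fixes a b T \<rho> M C1 :: real
    and f J :: "real \<Rightarrow> real"
    and body :: "real \<Rightarrow> real \<Rightarrow> real"
    and E :: "real set"
  assumes "a < b" and "T > 0" and "\<rho> > 0"
    and "E \<subseteq> {0<..}"
    and "admissible_potential f"
    and "influence_function M J"
    and "youngs_modulus f J > 0"
    and "C1 > 0"
  shows "\<exists>C2>0. \<exists>C>0. \<forall>\<delta> D' g h (u :: real \<Rightarrow> real \<Rightarrow> real) (ul :: real \<Rightarrow> real \<Rightarrow> real \<Rightarrow> real).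
    D' \<subseteq> {a..b} \<longrightarrow>
    \<delta> = setdist D' {a, b} \<longrightarrow>
    (\<forall>x. x \<notin> D' \<longrightarrow> g x = 0 \<and> h x = 0) \<longrightarrow>
    elastodynamic_solution a b T \<rho> (youngs_modulus f J) body g h u \<longrightarrow>
    (\<forall>\<epsilon>\<in>E. peridynamic_solution a b T \<rho> f J body g h \<epsilon> (ul \<epsilon>)) \<longrightarrow>
    (\<forall>\<epsilon>\<in>E. \<forall>t\<in>{0..T}. C_k_on 4 {a..b} (ul \<epsilon> t)) \<longrightarrow>
    (SUP \<epsilon>\<in>E. SUP (x, t)\<in>{a..b} \<times> {0..T}.
       ereal \<bar>(deriv_on {a..b} ^^ 4) (ul \<epsilon> t) x\<bar>) < ereal C1 \<longrightarrow>
    (\<forall>\<epsilon>\<in>E.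
       (SUP t\<in>{0..T}. ereal (error_energy a b T \<rho> (youngs_modulus f J)
          (\<lambda>t x. ul \<epsilon> t x - u t x) t)) \<le> ereal (C2 * \<epsilon> ^ 4) \<and>
       (SUP t\<in>{0..T}. ereal (H1_norm a b (\<lambda>x. ul \<epsilon> t x - u t x))) \<le> ereal (C * \<epsilon>\<^sup>2))"
proof -
  let ?Y = "youngs_modulus f J"
  define C2 where "C2 = exp T * T * ((b - a) * (?Y * (C1 / 12))\<^sup>2 / \<rho>)"
  define C where "C = sqrt ((4 * (b - a)\<^sup>2 + 1) / ?Y * C2)"
  have "C2 > 0"
    using assms by (simp add: C2_def)
  have "4 * (b - a)\<^sup>2 + 1 > 0"
    by (intro add_nonneg_pos) auto
  then have "C > 0"
    using \<open>C2 > 0\<close> assms by (simp add: C_def)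
  have estimate: "error_energy a b T \<rho> ?Y (\<lambda>t x. ul \<epsilon> t x - u t x) t \<le> C2 * \<epsilon> ^ 4 \<and>
      H1_norm a b (\<lambda>x. ul \<epsilon> t x - u t x) \<le> C * \<epsilon>\<^sup>2"
    if u: "elastodynamic_solution a b T \<rho> ?Y body g h u"
      and ul: "peridynamic_solution a b T \<rho> f J body g h \<epsilon> (ul \<epsilon>)"
      and C4: "\<forall>t\<in>{0..T}. C_k_on 4 {a..b} (ul \<epsilon> t)"
      and fourth: "(SUP \<epsilon>\<in>E. SUP (x, t)\<in>{a..b} \<times> {0..T}.
        ereal \<bar>(deriv_on {a..b} ^^ 4) (ul \<epsilon> t) x\<bar>) < ereal C1"
      and \<epsilon>: "\<epsilon> \<in> E" and t: "t \<in> {0..T}"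
    for g h u ul \<epsilon> t
  proof -
    have "\<bar>(deriv_on {a..b} ^^ 4) (ul \<epsilon> s) x\<bar> \<le> C1" if "s \<in> {0..T}" "x \<in> {a..b}" for s x
    proof -
      have "ereal \<bar>(deriv_on {a..b} ^^ 4) (ul \<epsilon> s) x\<bar> \<le> (SUP \<epsilon>\<in>E. SUP (x, t)\<in>{a..b} \<times> {0..T}.
          ereal \<bar>(deriv_on {a..b} ^^ 4) (ul \<epsilon> t) x\<bar>)"
        by (rule SUP_upper2[OF \<epsilon>], rule SUP_upper2[of "(x, s)"]) (use that in auto)
      then have "ereal \<bar>(deriv_on {a..b} ^^ 4) (ul \<epsilon> s) x\<bar> < ereal C1"
        using fourth by (rule le_less_trans)
      then show ?thesis by simp
    qed
    then interpret peridynamic_error f J M a b T \<rho> C1 \<epsilon> body u "ul \<epsilon>" g h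
      using assms u ul C4 \<epsilon> by unfold_locales auto
    have energy: "error_energy a b T \<rho> ?Y (\<lambda>t x. ul \<epsilon> t x - u t x) t \<le> C2 * \<epsilon> ^ 4"
      using error_energy_bound[OF t] by (simp add: C2_def)
    have "(H1_norm a b (\<lambda>x. ul \<epsilon> t x - u t x))\<^sup>2
        \<le> (4 * (b - a)\<^sup>2 + 1) / ?Y * error_energy a b T \<rho> ?Y (\<lambda>t x. ul \<epsilon> t x - u t x) t"
      by (rule error_H1_norm_le_energy[OF t])
    also have "\<dots> \<le> (4 * (b - a)\<^sup>2 + 1) / ?Y * (C2 * \<epsilon> ^ 4)"
      using energy assms by (intro mult_left_mono) auto
    also have "\<dots> = (C * \<epsilon>\<^sup>2)\<^sup>2"
      using \<open>C2 > 0\<close> assms(7)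
      by (simp add: C_def power_mult_distrib flip: power_mult)
    finally have "H1_norm a b (\<lambda>x. ul \<epsilon> t x - u t x) \<le> C * \<epsilon>\<^sup>2"
      by (rule power2_le_imp_le) (use \<open>C > 0\<close> in simp)
    then show ?thesis
      using energy by blast
  qed
  show ?thesis
    using \<open>C2 > 0\<close> \<open>C > 0\<close> estimate
    by (intro exI[of _ C2] exI[of _ C] conjI allI impI ballI SUP_least) auto
qed

end
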